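(* Let $\gamma\in\mathbb{R}$ and $n\in\mathbb{N}$, $n\geq 2$. For $s\in\mathbb{R}$ and $f\in C_0^\infty(\mathbb{R}^n\backslash\{0\})$ consider the inequality $$\int_{\mathbb{R}^n} |x|^\gamma|(\Delta f)(x)|^2 \, d^n x \geq - s \int_{\mathbb{R}^n} |x|^{\gamma-2} |(\nabla f)(x)|^2 \, d^n x + \Big[\frac{\gamma+n-4}{4}\Big]^2 \big[(\gamma-n)^2+4s\big] \int_{\mathbb{R}^n} |x|^{\gamma-4} |f(x)|^2 \, d^n x. \quad ( * )$$ Then the following assertions hold: $(i)$ If $\gamma\in\big[2-(n-1)^{1/2},2+(n-1)^{1/2}\big]$, then $( * )$ holds for all $f\in C_0^\infty(\mathbb{R}^n\backslash\{0\})$ and all $s\in\big[-2^{-1}\{(n-2)^2+(\gamma-2)^2\},\infty\big)$. $(ii)$ If $\gamma\in\mathbb{R}\backslash\big[2-(n-1)^{1/2},2+(n-1)^{1/2}\big]$, then $( * )$ holds for all $f\in C_0^\infty(\mathbb{R}^n\backslash\{0\})$ and all $s\in\big[-2^{-1}\{(n-2)^2-(\gamma-2)^2\}+1-n,\infty\big)$.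
   Context: $C_0^\infty(\mathbb{R}^n\backslash\{0\})$ denotes the complex-valued infinitely differentiable functions with compact support contained in $\mathbb{R}^n\backslash\{0\}$. *)

theory Defs
  imports "HOL-Analysis.Analysis"
begin

primrec continuously_differentiable :: "nat \<Rightarrow> ('a::euclidean_space \<Rightarrow> 'b::real_normed_vector) \<Rightarrow> bool"
  where
    "continuously_differentiable 0 f \<longleftrightarrow> continuous_on UNIV f"
  | "continuously_differentiable (Suc k) f \<longleftrightarrow>
       (\<forall>x. f differentiable (at x)) \<and>
       (\<forall>v. continuously_differentiable k (\<lambda>x. frechet_derivative f (at x) v))"

definition smooth :: "('a::euclidean_space \<Rightarrow> 'b::real_normed_vector) \<Rightarrow> bool"
  where "smooth f \<longleftrightarrow> (\<forall>k. continuously_differentiable k f)"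

(* C_0^\<infinity>(\<Omega>) for open \<Omega>; its elements are represented by their extensions by zero to the
   whole space. Since the support is a compact subset of \<Omega>, smoothness on the whole space and
   smoothness on \<Omega> coincide. *)
definition test_functions :: "'a::euclidean_space set \<Rightarrow> ('a \<Rightarrow> complex) set"
  where "test_functions \<Omega> =
    {f. smooth f \<and> compact (closure {x. f x \<noteq> 0}) \<and> closure {x. f x \<noteq> 0} \<subseteq> \<Omega>}"

definition partial_deriv :: "'n \<Rightarrow> (real^'n::finite \<Rightarrow> complex) \<Rightarrow> real^'n \<Rightarrow> complex"
  where "partial_deriv i f x = frechet_derivative f (at x) (axis i 1)"

definition gradient :: "(real^'n::finite \<Rightarrow> complex) \<Rightarrow> real^'n \<Rightarrow> complex^'n"
  where "gradient f x = (\<chi> i. partial_deriv i f x)"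

definition laplacian :: "(real^'n::finite \<Rightarrow> complex) \<Rightarrow> real^'n \<Rightarrow> complex"
  where "laplacian f x = (\<Sum>i\<in>UNIV. partial_deriv i (partial_deriv i f) x)"

(* For f in C_0^\<infinity>(R^n - {0}) all three integrands are continuous with compact support in
   R^n - {0}, so the Bochner integrals are genuine and the value of norm x powr a at x = 0
   plays no role. *)
definition rellich_inequality :: "real \<Rightarrow> real \<Rightarrow> (real^'n::finite \<Rightarrow> complex) \<Rightarrow> bool"
  where "rellich_inequality \<gamma> s f \<longleftrightarrow>
    (let n = real CARD('n) in
      (LINT x|lborel. norm x powr \<gamma> * (norm (laplacian f x))\<^sup>2)
      \<ge> - s * (LINT x|lborel. norm x powr (\<gamma> - 2) * (norm (gradient f x))\<^sup>2)
        + ((\<gamma> + n - 4) / 4)\<^sup>2 * ((\<gamma> - n)\<^sup>2 + 4 * s)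
            * (LINT x|lborel. norm x powr (\<gamma> - 4) * (norm (f x))\<^sup>2))"

end

theory Submission
  imports Defs
begin

text \<open>With \<open>E\<close> the Euler field and \<open>\<Delta>\<^sub>S\<close> the spherical Laplacian,
  \<open>\<bar>x\<bar>\<^sup>2 \<Delta> = E\<^sup>2 + (n - 2) E + \<Delta>\<^sub>S\<close>. After the shift of \<open>E\<close> which makes it skew-symmetric for the
  weight \<open>\<bar>x\<bar>\<^bsup>\<gamma>-4\<^esup>\<close>, expanding the square turns the inequality into one between a few nonnegative
  quadratic forms. The only deep ingredient is that the spectrum of \<open>- \<Delta>\<^sub>S\<close> avoids \<open>(0, n - 1)\<close>, in the
  form \<open>\<integral> \<bar>\<Delta>\<^sub>S f\<bar>\<^sup>2 \<ge> (n - 1) \<integral> \<bar>\<nabla>\<^sub>S f\<bar>\<^sup>2\<close>. For \<open>n \<ge> 3\<close> this follows from Bochner's identity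
  (Lichnerowicz). For \<open>n = 2\<close> Bochner's identity degenerates and the claim is Wirtinger's inequality on
  the orbits of the rotation group. Everything is done with integrals over the whole space: the
  tangential operators commute with radial weights, so no polar coordinates are needed.\<close>

section \<open>Smooth functions and symmetry of second derivatives\<close>

text \<open>Both parameter ranges come from one comparison. After the expansion the terms in
  \<integral> |x|^(\<gamma>-4) |f|^2 cancel and two nonnegative forms are dropped. What is left is a
  combination of Q (shifted radial derivative), Y (tangential gradient) and Z (spherical Laplacian).
  Once Z \<ge> (n - 1) Y is inserted, it is nonnegative as soon as the coefficients of Q and of Y
  are, that is, as soon as s + ((n - 2)^2 - (\<gamma> - 2)^2) / 2 is at least the negative of the
  smaller of (\<gamma> - 2)^2 and n - 1. Which of the two is smaller separates (i) from (ii). The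
  gap is stated with the tangential gradient instead of the function, so both of its sides vanish on
  radial functions and the eigenvalue 0 is covered without splitting f into spherical modes.
  Smoothness is given through iterated directional derivatives, which do not commute by definition;
  every commutator computation below therefore rests on the symmetry of second derivatives.\<close>

lemma has_real_derivative_along_line:
  fixes f :: "'a::real_normed_vector \<Rightarrow> real"
  assumes "\<And>x. f differentiable (at x)"
  shows "((\<lambda>s. f (y + s *\<^sub>R u)) has_real_derivative frechet_derivative f (at (y + s *\<^sub>R u)) u) (at s)"
proof -
  have "(f has_derivative frechet_derivative f (at (y + s *\<^sub>R u))) (at (y + s *\<^sub>R u))"
    using assms frechet_derivative_works by blast
  moreover have "((\<lambda>s. y + s *\<^sub>R u) has_derivative (\<lambda>s. s *\<^sub>R u)) (at s)"
    by (auto intro!: derivative_eq_intros)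
  ultimately have "((\<lambda>s. f (y + s *\<^sub>R u)) has_derivative
      (\<lambda>s'. frechet_derivative f (at (y + s *\<^sub>R u)) (s' *\<^sub>R u))) (at s)"
    using has_derivative_compose by blast
  moreover have "(\<lambda>s'. frechet_derivative f (at (y + s *\<^sub>R u)) (s' *\<^sub>R u)) =
      (*) (frechet_derivative f (at (y + s *\<^sub>R u)) u)"
    using linear_frechet_derivative[OF assms] by (auto simp: linear_cmul)
  ultimately show ?thesis
    by (simp add: has_field_derivative_def)
qed

text \<open>The mean value theorem is used twice: along \<open>u\<close> for the difference of
  \<open>f\<close> and its translate by \<open>h *\<^sub>R v\<close>, then along \<open>v\<close>
  for the derivative so produced.\<close>

lemma double_difference_mean_value:
  fixes f :: "'a::real_normed_vector \<Rightarrow> real"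
  assumes f: "\<And>x. f differentiable (at x)"
    and fu: "\<And>x. (\<lambda>y. frechet_derivative f (at y) u) differentiable (at x)" and "0 < h"
  obtains \<xi> \<eta> where "0 < \<xi>" "\<xi> < h" "0 < \<eta>" "\<eta> < h"
    "f (x + h *\<^sub>R u + h *\<^sub>R v) - f (x + h *\<^sub>R u) - f (x + h *\<^sub>R v) + f x =
      h * h * frechet_derivative (\<lambda>y. frechet_derivative f (at y) u) (at (x + \<xi> *\<^sub>R u + \<eta> *\<^sub>R v)) v"
proof -
  let ?g = "\<lambda>s. f ((x + h *\<^sub>R v) + s *\<^sub>R u) - f (x + s *\<^sub>R u)"
  let ?fu = "\<lambda>y. frechet_derivative f (at y) u"
  have "\<exists>z>0. z < h \<and> ?g h - ?g 0 = (h - 0) * (?fu ((x + h *\<^sub>R v) + z *\<^sub>R u) - ?fu (x + z *\<^sub>R u))"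
    using \<open>0 < h\<close> by (intro MVT2 DERIV_diff has_real_derivative_along_line f)
  then obtain \<xi> where \<xi>: "0 < \<xi>" "\<xi> < h"
    "?g h - ?g 0 = h * (?fu ((x + h *\<^sub>R v) + \<xi> *\<^sub>R u) - ?fu (x + \<xi> *\<^sub>R u))"
    by auto
  let ?k = "\<lambda>t. ?fu ((x + \<xi> *\<^sub>R u) + t *\<^sub>R v)"
  have "\<exists>z>0. z < h \<and> ?k h - ?k 0 = (h - 0) * frechet_derivative ?fu (at ((x + \<xi> *\<^sub>R u) + z *\<^sub>R v)) v"
    using \<open>0 < h\<close> by (intro MVT2 has_real_derivative_along_line fu)
  then obtain \<eta> where \<eta>: "0 < \<eta>" "\<eta> < h"
    "?k h - ?k 0 = h * frechet_derivative ?fu (at ((x + \<xi> *\<^sub>R u) + \<eta> *\<^sub>R v)) v"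
    by auto
  show thesis
  proof (rule that[OF \<xi>(1,2) \<eta>(1,2)])
    have "f (x + h *\<^sub>R u + h *\<^sub>R v) - f (x + h *\<^sub>R u) - f (x + h *\<^sub>R v) + f x = ?g h - ?g 0"
      by (simp add: algebra_simps)
    also have "\<dots> = h * (?k h - ?k 0)"
      using \<xi>(3) by (simp add: algebra_simps)
    finally show "f (x + h *\<^sub>R u + h *\<^sub>R v) - f (x + h *\<^sub>R u) - f (x + h *\<^sub>R v) + f x =
      h * h * frechet_derivative ?fu (at (x + \<xi> *\<^sub>R u + \<eta> *\<^sub>R v)) v"
      using \<eta>(3) by simp
  qed
qed

text \<open>The double difference over a parallelogram is symmetric in \<open>u\<close> and
  \<open>v\<close>, so arbitrarily close to \<open>x\<close> each mixed derivative takes a value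
  that the other one also takes; continuity at \<open>x\<close> does the rest.\<close>

lemma frechet_derivative_commute:
  fixes f :: "'a::real_normed_vector \<Rightarrow> real"
  assumes f: "\<And>x. f differentiable (at x)"
    and fu: "\<And>x. (\<lambda>y. frechet_derivative f (at y) u) differentiable (at x)"
    and fv: "\<And>x. (\<lambda>y. frechet_derivative f (at y) v) differentiable (at x)"
    and cuv: "isCont (\<lambda>z. frechet_derivative (\<lambda>y. frechet_derivative f (at y) u) (at z) v) x"
    and cvu: "isCont (\<lambda>z. frechet_derivative (\<lambda>y. frechet_derivative f (at y) v) (at z) u) x"
  shows "frechet_derivative (\<lambda>y. frechet_derivative f (at y) u) (at x) v =
         frechet_derivative (\<lambda>y. frechet_derivative f (at y) v) (at x) u"
proof -
  let ?A = "\<lambda>z. frechet_derivative (\<lambda>y. frechet_derivative f (at y) u) (at z) v"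
  let ?B = "\<lambda>z. frechet_derivative (\<lambda>y. frechet_derivative f (at y) v) (at z) u"
  have "\<bar>?A x - ?B x\<bar> \<le> e" if "e > 0" for e
  proof -
    from \<open>e > 0\<close> have "e / 2 > 0" by simp
    then obtain d1 where d1: "d1 > 0" "\<And>z. dist z x < d1 \<Longrightarrow> dist (?A z) (?A x) < e/2"
      using cuv unfolding continuous_at_eps_delta by metis
    from \<open>e / 2 > 0\<close> obtain d2 where d2: "d2 > 0" "\<And>z. dist z x < d2 \<Longrightarrow> dist (?B z) (?B x) < e/2"
      using cvu unfolding continuous_at_eps_delta by metis
    \<comment> \<open>The summand 1 keeps \<open>M\<close> positive for zero vectors and makes the
      distance estimate strict.\<close>
    define M where "M = norm u + norm v + 1"
    define h where "h = min d1 d2 / M"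
    have M: "M > 0" by (simp add: M_def add_nonneg_pos)
    have h: "h > 0" using d1(1) d2(1) M by (simp add: h_def)
    have near: "dist (x + a *\<^sub>R u + b *\<^sub>R v) x < min d1 d2"
      if "0 < a" "a < h" "0 < b" "b < h" for a b
    proof -
      have "dist (x + a *\<^sub>R u + b *\<^sub>R v) x \<le> a * norm u + b * norm v"
        using that norm_triangle_ineq[of "a *\<^sub>R u" "b *\<^sub>R v"] by (simp add: dist_norm add.assoc)
      also have "\<dots> \<le> h * norm u + h * norm v"
        using that by (intro add_mono mult_right_mono) auto
      also have "\<dots> < h * M" using h by (simp add: M_def algebra_simps)
      also have "\<dots> = min d1 d2" using M by (simp add: h_def)
      finally show ?thesis .
    qed
    obtain a b where ab: "0 < a" "a < h" "0 < b" "b < h"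
      "f (x + h *\<^sub>R u + h *\<^sub>R v) - f (x + h *\<^sub>R u) - f (x + h *\<^sub>R v) + f x
         = h * h * ?A (x + a *\<^sub>R u + b *\<^sub>R v)"
      using double_difference_mean_value[OF f fu h] by metis
    obtain a' b' where ab': "0 < a'" "a' < h" "0 < b'" "b' < h"
      "f (x + h *\<^sub>R v + h *\<^sub>R u) - f (x + h *\<^sub>R v) - f (x + h *\<^sub>R u) + f x
         = h * h * ?B (x + a' *\<^sub>R v + b' *\<^sub>R u)"
      using double_difference_mean_value[OF f fv h] by metis
    have "h * h * ?A (x + a *\<^sub>R u + b *\<^sub>R v) = h * h * ?B (x + b' *\<^sub>R u + a' *\<^sub>R v)"
      using ab(5) ab'(5) by (simp add: algebra_simps)
    then have "?A (x + a *\<^sub>R u + b *\<^sub>R v) = ?B (x + b' *\<^sub>R u + a' *\<^sub>R v)"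
      using h by simp
    moreover have "dist (?A (x + a *\<^sub>R u + b *\<^sub>R v)) (?A x) < e/2"
      using near[OF ab(1-4)] d1(2) by simp
    moreover have "dist (?B (x + b' *\<^sub>R u + a' *\<^sub>R v)) (?B x) < e/2"
      using near[OF ab'(3,4,1,2)] d2(2) by simp
    ultimately show ?thesis unfolding dist_real_def by linarith
  qed
  then have "\<bar>?A x - ?B x\<bar> \<le> 0" by (rule field_le_epsilon) simp
  then show ?thesis by simp
qed

text \<open>Level \<open>Suc k\<close> does not literally contain level \<open>k\<close>: continuity
  of \<open>f\<close> has to be recovered from differentiability in the base case.\<close>

lemma continuously_differentiable_SucD:
  "continuously_differentiable (Suc k) f \<Longrightarrow> continuously_differentiable k f"
proof (induction k arbitrary: f)
  case 0
  then show ?case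
    by (auto simp: continuous_on_eq_continuous_at intro: differentiable_imp_continuous_within)
next
  case (Suc k)
  show ?case
    unfolding continuously_differentiable.simps(2)
  proof (intro conjI allI)
    fix v
    have "continuously_differentiable (Suc k) (\<lambda>x. frechet_derivative f (at x) v)"
      using Suc.prems unfolding continuously_differentiable.simps(2)[of "Suc k"] by blast
    then show "continuously_differentiable k (\<lambda>x. frechet_derivative f (at x) v)" by (rule Suc.IH)
  qed (use Suc.prems in auto)
qed

section \<open>Closure properties of C^k and smooth functions\<close>

lemma continuously_differentiable_const: "continuously_differentiable k (\<lambda>x. c)"
  by (induction k arbitrary: c) auto

lemma continuously_differentiable_bounded_linear_compose:
  fixes f :: "'a::euclidean_space \<Rightarrow> 'b::real_normed_vector"
  assumes L: "bounded_linear L"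
  shows "continuously_differentiable k f \<Longrightarrow> continuously_differentiable k (\<lambda>x. L (f x))"
proof (induction k arbitrary: f)
  case 0
  then show ?case using bounded_linear.continuous_on[OF L] by auto
next
  case (Suc k)
  have D: "((\<lambda>x. L (f x)) has_derivative (\<lambda>v. L (frechet_derivative f (at x) v))) (at x)" for x
    using Suc.prems bounded_linear.has_derivative[OF L] by (auto simp: frechet_derivative_works)
  show ?case using Suc.prems Suc.IH
    by (auto simp: frechet_derivative_at[OF D, symmetric] differentiable_def intro: D)
qed

lemma continuously_differentiable_add:
  fixes f g :: "'a::euclidean_space \<Rightarrow> 'b::real_normed_vector"
  shows "continuously_differentiable k f \<Longrightarrow> continuously_differentiable k g \<Longrightarrow>
    continuously_differentiable k (\<lambda>x. f x + g x)"
proof (induction k arbitrary: f g)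
  case 0
  then show ?case by (auto intro: continuous_on_add)
next
  case (Suc k)
  have D: "((\<lambda>x. f x + g x) has_derivative
      (\<lambda>v. frechet_derivative f (at x) v + frechet_derivative g (at x) v)) (at x)" for x
    using Suc.prems by (auto simp: frechet_derivative_works intro: has_derivative_add)
  show ?case using Suc
    by (auto simp: frechet_derivative_at[OF D, symmetric] differentiable_def intro: D)
qed

lemma continuously_differentiable_mult:
  fixes f g :: "'a::euclidean_space \<Rightarrow> real"
  shows "continuously_differentiable k f \<Longrightarrow> continuously_differentiable k g \<Longrightarrow>
    continuously_differentiable k (\<lambda>x. f x * g x)"
proof (induction k arbitrary: f g)
  case 0
  then show ?case by (auto intro: continuous_on_mult)
next
  case (Suc k)
  have D: "((\<lambda>x. f x * g x) has_derivative
      (\<lambda>v. f x * frechet_derivative g (at x) v + frechet_derivative f (at x) v * g x)) (at x)" for x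
    using Suc.prems by (auto simp: frechet_derivative_works intro: has_derivative_mult)
  \<comment> \<open>The product rule leaves one factor undifferentiated, and the induction
    hypothesis wants that factor at level \<open>k\<close>.\<close>
  have "continuously_differentiable k f" "continuously_differentiable k g"
    using Suc.prems continuously_differentiable_SucD by blast+
  then show ?case using Suc
    by (auto simp: frechet_derivative_at[OF D, symmetric] differentiable_def
        intro: D continuously_differentiable_add)
qed

lemma smooth_differentiable: "smooth f \<Longrightarrow> f differentiable (at x)"
  by (metis continuously_differentiable.simps(2) smooth_def)

lemma smooth_frechet_derivative: "smooth f \<Longrightarrow> smooth (\<lambda>x. frechet_derivative f (at x) v)"
  by (metis continuously_differentiable.simps(2) smooth_def)

lemma smooth_continuous: "smooth f \<Longrightarrow> continuous_on S f"
  by (metis continuously_differentiable.simps(1) smooth_def continuous_on_subset subset_UNIV)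

lemma smooth_const [intro]: "smooth (\<lambda>x. c)"
  by (simp add: smooth_def continuously_differentiable_const)

lemma smooth_bounded_linear_compose: "bounded_linear L \<Longrightarrow> smooth f \<Longrightarrow> smooth (\<lambda>x. L (f x))"
  by (simp add: smooth_def continuously_differentiable_bounded_linear_compose)

lemma smooth_add [intro]: "smooth f \<Longrightarrow> smooth g \<Longrightarrow> smooth (\<lambda>x. f x + g x)"
  by (simp add: smooth_def continuously_differentiable_add)

lemma smooth_mult [intro]:
  fixes f g :: "'a::euclidean_space \<Rightarrow> real"
  shows "smooth f \<Longrightarrow> smooth g \<Longrightarrow> smooth (\<lambda>x. f x * g x)"
  by (simp add: smooth_def continuously_differentiable_mult)

lemma smooth_sum [intro]: "(\<And>i. i \<in> I \<Longrightarrow> smooth (f i)) \<Longrightarrow> smooth (\<lambda>x. \<Sum>i\<in>I. f i x)"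
  by (induction I rule: infinite_finite_induct) auto

lemma smooth_diff [intro]:
  fixes f g :: "'a::euclidean_space \<Rightarrow> real"
  assumes "smooth f" "smooth g"
  shows "smooth (\<lambda>x. f x - g x)"
  using smooth_add[OF assms(1) smooth_mult[OF smooth_const assms(2), of "-1"]] by simp

lemma smooth_bounded_linear:
  assumes "bounded_linear (f :: 'a::euclidean_space \<Rightarrow> 'b::real_normed_vector)"
  shows "smooth f"
  unfolding smooth_def
proof
  fix k
  have D: "(f has_derivative f) (at x)" for x
    by (rule bounded_linear.has_derivative[OF assms has_derivative_ident])
  show "continuously_differentiable k f"
  proof (cases k)
    case 0
    then show ?thesis using linear_continuous_on[OF assms] by simp
  next
    case (Suc j)
    then show ?thesis
      by (auto simp: frechet_derivative_at[OF D, symmetric] differentiable_def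
          intro: D continuously_differentiable_const)
  qed
qed

lemma smooth_component [intro]: "smooth (\<lambda>x::real^'n::finite. x $ i)"
  by (intro smooth_bounded_linear bounded_linear_vec_nth)

lemma smooth_frechet_derivative_commute:
  fixes f :: "'a::euclidean_space \<Rightarrow> real"
  assumes "smooth f"
  shows "frechet_derivative (\<lambda>y. frechet_derivative f (at y) u) (at x) v =
         frechet_derivative (\<lambda>y. frechet_derivative f (at y) v) (at x) u"
proof (rule frechet_derivative_commute)
  have "continuous_on UNIV (\<lambda>z. frechet_derivative (\<lambda>y. frechet_derivative f (at y) a) (at z) b)" for a b
    by (intro smooth_continuous smooth_frechet_derivative assms)
  then show "isCont (\<lambda>z. frechet_derivative (\<lambda>y. frechet_derivative f (at y) u) (at z) v) x"
    "isCont (\<lambda>z. frechet_derivative (\<lambda>y. frechet_derivative f (at y) v) (at z) u) x"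
    by (simp_all add: continuous_on_eq_continuous_at)
qed (intro smooth_differentiable smooth_frechet_derivative assms)+

lemma smooth_minus [intro]:
  fixes f :: "'a::euclidean_space \<Rightarrow> real"
  shows "smooth f \<Longrightarrow> smooth (\<lambda>x. - f x)"
  using smooth_mult[OF smooth_const, of f "-1"] by simp

lemma smooth_norm_square [intro]: "smooth (\<lambda>x::real^'n::finite. (norm x)\<^sup>2)"
proof -
  have "(\<lambda>x::real^'n. (norm x)\<^sup>2) = (\<lambda>x. \<Sum>i\<in>UNIV. x $ i * x $ i)"
    by (simp add: power2_norm_eq_inner inner_vec_def)
  then show ?thesis by (simp add: smooth_sum smooth_mult smooth_component)
qed

section \<open>Partial derivatives and integration by parts\<close>

text \<open>Real counterpart of \<open>partial_deriv\<close>. All estimates are made for real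
  functions; complex ones enter at the end through their real and imaginary parts.\<close>

definition pd :: "'n \<Rightarrow> (real^'n::finite \<Rightarrow> real) \<Rightarrow> real^'n \<Rightarrow> real"
  where "pd i f x = frechet_derivative f (at x) (axis i 1)"

lemma smooth_pd [intro]: "smooth f \<Longrightarrow> smooth (pd i f)"
  unfolding pd_def[abs_def] by (rule smooth_frechet_derivative)

lemma pd_eqI: "(f has_derivative f') (at x) \<Longrightarrow> pd i f x = f' (axis i 1)"
  unfolding pd_def by (simp add: frechet_derivative_at[symmetric])

lemma smooth_has_derivative: "smooth f \<Longrightarrow> (f has_derivative frechet_derivative f (at x)) (at x)"
  using smooth_differentiable frechet_derivative_works by blast

lemma pd_const: "pd i (\<lambda>x. c) x = 0"
  by (rule pd_eqI) (rule has_derivative_const)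

lemma pd_component: "pd i (\<lambda>x. x $ j) x = (if i = j then 1 else 0)"
  by (subst pd_eqI[OF bounded_linear.has_derivative[OF bounded_linear_vec_nth has_derivative_ident]])
    (simp add: axis_def)

lemma pd_norm_square: "pd i (\<lambda>x. (norm x)\<^sup>2) x = 2 * x $ i"
proof -
  have "((\<lambda>x. (norm x)\<^sup>2) has_derivative (\<lambda>v. 2 * (x \<bullet> v))) (at x)"
    unfolding power2_norm_eq_inner by (auto intro!: derivative_eq_intros simp: inner_commute)
  then show ?thesis by (simp add: pd_eqI inner_axis)
qed

lemma pd_add: "smooth f \<Longrightarrow> smooth g \<Longrightarrow> pd i (\<lambda>x. f x + g x) x = pd i f x + pd i g x"
  by (subst pd_eqI[OF has_derivative_add]) (auto intro: smooth_has_derivative simp: pd_def)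

lemma pd_diff: "smooth f \<Longrightarrow> smooth g \<Longrightarrow> pd i (\<lambda>x. f x - g x) x = pd i f x - pd i g x"
  by (subst pd_eqI[OF has_derivative_diff]) (auto intro: smooth_has_derivative simp: pd_def)

lemma pd_minus: "smooth f \<Longrightarrow> pd i (\<lambda>x. - f x) x = - pd i f x"
  by (subst pd_eqI[OF has_derivative_minus]) (auto intro: smooth_has_derivative simp: pd_def)

lemma pd_mult:
  "smooth f \<Longrightarrow> smooth g \<Longrightarrow> pd i (\<lambda>x. f x * g x) x = f x * pd i g x + pd i f x * g x"
  by (subst pd_eqI[OF has_derivative_mult]) (auto intro: smooth_has_derivative simp: pd_def)

lemma pd_sum: "(\<And>j. j \<in> I \<Longrightarrow> smooth (f j)) \<Longrightarrow> pd i (\<lambda>x. \<Sum>j\<in>I. f j x) x = (\<Sum>j\<in>I. pd i (f j) x)"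
  by (subst pd_eqI[OF has_derivative_sum]) (auto intro: smooth_has_derivative simp: pd_def)

lemma pd_commute: "smooth f \<Longrightarrow> pd i (pd j f) = pd j (pd i f)"
  unfolding pd_def[abs_def] by (rule ext) (rule smooth_frechet_derivative_commute)

lemmas smooth_simps = smooth_const smooth_component smooth_norm_square smooth_add smooth_diff
  smooth_minus smooth_mult smooth_sum smooth_pd

lemmas pd_simps = pd_const pd_component pd_norm_square pd_add pd_diff pd_minus pd_mult pd_sum

text \<open>Compact support in the punctured space, encoded by a closed annulus: the two radii are
  easier to carry through products, sums and derivatives than the closure of a set.\<close>

definition punctured_test :: "(real^'n::finite \<Rightarrow> real) \<Rightarrow> bool"
  where "punctured_test f \<longleftrightarrow>
    smooth f \<and> (\<exists>a>0. \<exists>b. \<forall>x. f x \<noteq> 0 \<longrightarrow> a \<le> norm x \<and> norm x \<le> b)"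

lemma punctured_test_smooth: "punctured_test f \<Longrightarrow> smooth f"
  by (simp add: punctured_test_def)

lemma punctured_testE:
  assumes "punctured_test f"
  obtains a b where "0 < a" "\<And>x. norm x < a \<Longrightarrow> f x = 0" "\<And>x. b < norm x \<Longrightarrow> f x = 0"
  using assms unfolding punctured_test_def by (metis not_le)

lemma punctured_test_mult_left:
  "smooth f \<Longrightarrow> punctured_test g \<Longrightarrow> punctured_test (\<lambda>x. f x * g x)"
  unfolding punctured_test_def by (auto intro!: smooth_mult)

lemma punctured_test_mult_right:
  "punctured_test f \<Longrightarrow> smooth g \<Longrightarrow> punctured_test (\<lambda>x. f x * g x)"
  unfolding punctured_test_def by (auto intro!: smooth_mult)

lemma punctured_test_add:
  assumes "punctured_test f" "punctured_test g"
  shows "punctured_test (\<lambda>x. f x + g x)"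
proof -
  obtain a b where f: "0 < a" "\<And>x. norm x < a \<Longrightarrow> f x = 0" "\<And>x. b < norm x \<Longrightarrow> f x = 0"
    using punctured_testE[OF assms(1)] by metis
  obtain c d where g: "0 < c" "\<And>x. norm x < c \<Longrightarrow> g x = 0" "\<And>x. d < norm x \<Longrightarrow> g x = 0"
    using punctured_testE[OF assms(2)] by metis
  have "min a c \<le> norm x \<and> norm x \<le> max b d" if "f x + g x \<noteq> 0" for x
    using that f(2,3)[of x] g(2,3)[of x] by linarith
  moreover have "min a c > 0" using f(1) g(1) by simp
  ultimately show ?thesis
    using assms unfolding punctured_test_def by blast
qed

lemma punctured_test_cmult: "punctured_test f \<Longrightarrow> punctured_test (\<lambda>x. c * f x)"
  by (intro punctured_test_mult_left smooth_const)

lemma punctured_test_minus: "punctured_test f \<Longrightarrow> punctured_test (\<lambda>x. - f x)"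
  using punctured_test_cmult[of f "-1"] by simp

lemma punctured_test_diff:
  "punctured_test f \<Longrightarrow> punctured_test g \<Longrightarrow> punctured_test (\<lambda>x. f x - g x)"
  using punctured_test_add[OF _ punctured_test_minus, of f g] by simp

lemma punctured_test_const_0: "punctured_test (\<lambda>x. 0)"
  unfolding punctured_test_def by (auto intro: exI[of _ 1])

lemma punctured_test_sum:
  "(\<And>i. i \<in> I \<Longrightarrow> punctured_test (f i)) \<Longrightarrow> punctured_test (\<lambda>x. \<Sum>i\<in>I. f i x)"
  by (induction I rule: infinite_finite_induct)
    (simp_all add: punctured_test_const_0 punctured_test_add)

lemma pd_eq_0_if_locally_0:
  assumes "open S" "x \<in> S" "\<And>y. y \<in> S \<Longrightarrow> f y = 0"
  shows "pd i f x = 0"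
proof -
  have "(f has_derivative (\<lambda>v. 0)) (at x)"
    using assms by (intro has_derivative_transform_within_open[OF has_derivative_const, of S x 0]) auto
  then show ?thesis by (rule pd_eqI)
qed

lemma punctured_test_pd:
  assumes "punctured_test f"
  shows "punctured_test (pd i f)"
proof -
  obtain a b where f: "0 < a" "\<And>x. norm x < a \<Longrightarrow> f x = 0" "\<And>x. b < norm x \<Longrightarrow> f x = 0"
    using punctured_testE[OF assms] by metis
  have "open {x::real^'n. norm x < a}" "open {x::real^'n. b < norm x}"
    by (auto intro!: open_Collect_less continuous_intros)
  then have "pd i f x = 0" if "norm x < a \<or> b < norm x" for x
    using that pd_eq_0_if_locally_0[of "{x. norm x < a}" x f i]
      pd_eq_0_if_locally_0[of "{x. b < norm x}" x f i] f by auto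
  then have "\<forall>x. pd i f x \<noteq> 0 \<longrightarrow> a \<le> norm x \<and> norm x \<le> b"
    by (meson not_le)
  then show ?thesis
    using f(1) smooth_pd[OF punctured_test_smooth[OF assms]] unfolding punctured_test_def by blast
qed

lemmas punctured_test_simps = punctured_test_mult_left punctured_test_mult_right
  punctured_test_add punctured_test_diff punctured_test_minus punctured_test_sum
  punctured_test_pd

lemma continuous_on_powr_mult_punctured_test:
  fixes f :: "real^'n::finite \<Rightarrow> real"
  assumes "punctured_test f"
  shows "continuous_on UNIV (\<lambda>x. norm x powr p * f x)"
proof -
  obtain a b where f: "0 < a" "\<And>x. norm x < a \<Longrightarrow> f x = 0"
    using punctured_testE[OF assms] by metis
  \<comment> \<open>An open cover on whose first piece the product vanishes identically and on whose
    second piece the weight is continuous.\<close>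
  have U: "(UNIV :: (real^'n) set) = {x. norm x < a} \<union> {x. 0 < norm x}"
    using f(1) by (auto simp del: zero_less_norm_iff)
  show ?thesis
    unfolding U
  proof (rule continuous_on_open_Un)
    show "continuous_on {x. norm x < a} (\<lambda>x. norm x powr p * f x)"
      by (rule continuous_on_eq[of _ "\<lambda>x. 0"]) (auto simp: f(2))
    show "continuous_on {x. 0 < norm x} (\<lambda>x. norm x powr p * f x)"
      using punctured_test_smooth[OF assms] by (intro continuous_intros smooth_continuous) auto
  qed (intro open_Collect_less continuous_intros)+
qed

lemma integrable_continuous_bounded_support:
  fixes f :: "'a::euclidean_space \<Rightarrow> real"
  assumes "continuous_on UNIV f" "\<And>x. b < norm x \<Longrightarrow> f x = 0"
  shows "integrable lborel f"
proof -
  have "integrable lborel (\<lambda>x. indicator (cball 0 b) x *\<^sub>R f x)"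
    using assms(1) by (intro borel_integrable_compact) (auto intro: continuous_on_subset)
  also have "(\<lambda>x. indicator (cball 0 b) x *\<^sub>R f x) = f"
    using assms(2) by (intro ext) (auto simp: indicator_def not_le)
  finally show ?thesis .
qed

lemma integrable_powr_mult_punctured_test:
  assumes "punctured_test f"
  shows "integrable lborel (\<lambda>x. norm x powr p * f x)"
proof -
  obtain b where "\<And>x. b < norm x \<Longrightarrow> f x = 0"
    using punctured_testE[OF assms] by metis
  then show ?thesis
    by (intro integrable_continuous_bounded_support[of _ b]
        continuous_on_powr_mult_punctured_test assms) simp
qed

section \<open>Integration by parts against a radial weight\<close>

lemma integral_lborel_translate:
  fixes f :: "'a::euclidean_space \<Rightarrow> real"
  assumes "f \<in> borel_measurable borel"
  shows "(LINT x|lborel. f (c + x)) = (LINT x|lborel. f x)"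
  using integral_distr[of "(+) c" lborel borel f] assms by (simp add: lborel_distr_plus)

text \<open>By translation invariance every difference quotient of \<open>G\<close> along
  \<open>v\<close> has integral 0; dominated convergence passes to the derivative. No iterated
  integrals or coordinates enter.\<close>

lemma integral_directional_derivative_eq_0:
  fixes G :: "'a::euclidean_space \<Rightarrow> real"
  assumes G: "\<And>x. G differentiable (at x)"
    and cont: "continuous_on UNIV (\<lambda>x. frechet_derivative G (at x) v)"
    and supp: "\<And>x. b < norm x \<Longrightarrow> G x = 0"
  shows "(LINT x|lborel. frechet_derivative G (at x) v) = 0"
proof -
  let ?D = "\<lambda>x. frechet_derivative G (at x) v"
  have contG: "continuous_on UNIV G"
    using G by (simp add: continuous_on_eq_continuous_at differentiable_imp_continuous_within)
  have D0: "?D x = 0" if "b < norm x" for x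
  proof -
    have "(G has_derivative (\<lambda>v. 0)) (at x)"
      using that supp
      by (intro has_derivative_transform_within_open[OF has_derivative_const, of "{x. b < norm x}" x 0])
        (auto intro!: open_Collect_less continuous_intros)
    then show ?thesis by (simp add: frechet_derivative_at[symmetric])
  qed
  have "bounded (?D ` cball 0 b)"
    using cont by (intro compact_imp_bounded compact_continuous_image)
      (auto intro: continuous_on_subset)
  then obtain M where M: "\<forall>x\<in>cball 0 b. \<bar>?D x\<bar> \<le> M"
    unfolding bounded_iff by auto
  \<comment> \<open>The maximum with 0 covers the points outside the ball, where the derivative
    vanishes, and also the case of an empty ball, where \<open>M\<close> may be negative.\<close>
  have DM: "\<bar>?D x\<bar> \<le> max M 0" for x
    using M D0[of x] by (cases "norm x \<le> b") (auto simp: le_max_iff_disj)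
  define s where "s k x = (G (inverse (real (Suc k)) *\<^sub>R v + x) - G x) * real (Suc k)" for k x
  have int: "integrable lborel G"
    using contG supp by (rule integrable_continuous_bounded_support)
  have meas: "G \<in> borel_measurable borel"
    using contG by (rule borel_measurable_continuous_onI)
  have int': "integrable lborel (\<lambda>x. G (c + x))" for c
    using integrable_distr_eq[of "(+) c" lborel borel G] int meas by (simp add: lborel_distr_plus)
  have "(LINT x|lborel. s k x) = 0" for k
    using int int'[of "inverse (real (Suc k)) *\<^sub>R v"] integral_lborel_translate[OF meas]
    unfolding s_def by simp
  moreover have "(\<lambda>k. LINT x|lborel. s k x) \<longlonglongrightarrow> (LINT x|lborel. ?D x)"
  \<comment> \<open>A difference quotient is a value of the derivative at an intermediate point,
    hence bounded by \<open>max M 0\<close>. The step lengths are at most 1, so the support grows by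
    at most \<open>norm v\<close>.\<close>
  proof (rule integral_dominated_convergence[where w = "\<lambda>x. indicator (cball 0 (b + norm v)) x * max M 0"])
    show "?D \<in> borel_measurable lborel"
      using borel_measurable_continuous_onI[OF cont] by simp
    show "s k \<in> borel_measurable lborel" for k
      unfolding s_def using int int' by (intro borel_measurable_integrable) auto
    show "integrable lborel (\<lambda>x::'a. indicator (cball 0 (b + norm v)) x * max M 0)"
      using borel_integrable_compact[of "cball 0 (b + norm v)" "\<lambda>x. max M 0"] by simp
    show "AE x in lborel. (\<lambda>k. s k x) \<longlonglongrightarrow> ?D x"
    proof (rule AE_I2)
      fix x
      have "((\<lambda>t. (G (x + t *\<^sub>R v) - G x) / t) \<longlongrightarrow> ?D x) (at 0)"
        using has_real_derivative_along_line[OF G, of x v 0]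
        by (simp add: DERIV_def)
      moreover have "filterlim (\<lambda>k. inverse (real (Suc k))) (at 0) sequentially"
        by (rule filterlim_atI[OF LIMSEQ_inverse_real_of_nat]) simp
      ultimately have "((\<lambda>k. (G (x + inverse (real (Suc k)) *\<^sub>R v) - G x) / inverse (real (Suc k))) \<longlongrightarrow> ?D x) sequentially"
        by (rule filterlim_compose)
      then show "(\<lambda>k. s k x) \<longlonglongrightarrow> ?D x"
        by (simp add: s_def add.commute divide_inverse)
    qed
    show "AE x in lborel. norm (s k x) \<le> indicator (cball 0 (b + norm v)) x * max M 0" for k
    proof (rule AE_I2)
      fix x
      let ?h = "inverse (real (Suc k))"
      have h: "0 < ?h" "?h \<le> 1" by (simp_all add: divide_simps del: of_nat_Suc)
      have "\<exists>z>0. z < ?h \<and> G (x + ?h *\<^sub>R v) - G (x + 0 *\<^sub>R v) = (?h - 0) * ?D (x + z *\<^sub>R v)"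
        using h by (intro MVT2 has_real_derivative_along_line G)
      then obtain z where "G (?h *\<^sub>R v + x) - G x = ?h * ?D (x + z *\<^sub>R v)"
        by (auto simp: add.commute)
      then have "s k x = ?D (x + z *\<^sub>R v)" by (simp add: s_def del: of_nat_Suc)
      then have 1: "\<bar>s k x\<bar> \<le> max M 0" using DM by simp
      show "norm (s k x) \<le> indicator (cball 0 (b + norm v)) x * max M 0"
      proof (cases "norm x \<le> b + norm v")
        case True
        then show ?thesis using 1 by simp
      next
        case False
        have "norm (?h *\<^sub>R v) \<le> norm v"
          using h mult_right_mono[OF h(2), of "norm v"] by simp
        moreover have "norm x \<le> norm (?h *\<^sub>R v + x) + norm (?h *\<^sub>R v)"
          using norm_triangle_ineq4[of "?h *\<^sub>R v + x" "?h *\<^sub>R v"] by simp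
        ultimately have "b < norm (?h *\<^sub>R v + x)" "b < norm x" using False norm_ge_zero[of v] by linarith+
        then have "s k x = 0" by (simp add: s_def supp del: of_nat_Suc)
        then show ?thesis using False by simp
      qed
    qed
  qed
  ultimately show ?thesis
    by (simp add: LIMSEQ_const_iff)
qed

definition radial_integral :: "real \<Rightarrow> (real^'n::finite \<Rightarrow> real) \<Rightarrow> real"
  where "radial_integral p f = (LINT x|lborel. norm x powr p * f x)"

lemma radial_integral_add:
  "punctured_test f \<Longrightarrow> punctured_test g \<Longrightarrow>
    radial_integral p (\<lambda>x. f x + g x) = radial_integral p f + radial_integral p g"
  unfolding radial_integral_def
  by (simp add: distrib_left integrable_powr_mult_punctured_test)

lemma radial_integral_diff:
  "punctured_test f \<Longrightarrow> punctured_test g \<Longrightarrow>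
    radial_integral p (\<lambda>x. f x - g x) = radial_integral p f - radial_integral p g"
  unfolding radial_integral_def
  by (simp add: right_diff_distrib integrable_powr_mult_punctured_test)

lemma radial_integral_cmult: "radial_integral p (\<lambda>x. c * f x) = c * radial_integral p f"
  unfolding radial_integral_def by (simp add: mult.left_commute)

lemma radial_integral_sum:
  "(\<And>i. i \<in> I \<Longrightarrow> punctured_test (f i)) \<Longrightarrow>
    radial_integral p (\<lambda>x. \<Sum>i\<in>I. f i x) = (\<Sum>i\<in>I. radial_integral p (f i))"
  unfolding radial_integral_def
  by (simp add: sum_distrib_left integrable_powr_mult_punctured_test)

lemma radial_integral_mono:
  fixes f g :: "real^'n::finite \<Rightarrow> real"
  assumes "punctured_test f" "punctured_test g" "\<And>x. x \<noteq> 0 \<Longrightarrow> f x \<le> g x"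
  shows "radial_integral p f \<le> radial_integral p g"
  unfolding radial_integral_def
proof (intro integral_mono integrable_powr_mult_punctured_test assms(1,2))
  show "norm x powr p * f x \<le> norm x powr p * g x" for x :: "real^'n"
    \<comment> \<open>At the origin both sides are 0, because \<open>0 powr p = 0\<close>.\<close>
    using assms(3)[of x] by (cases "x = 0") (auto intro: mult_left_mono)
qed

lemma radial_integral_nonneg: "(\<And>x. 0 \<le> f x) \<Longrightarrow> 0 \<le> radial_integral p f"
  unfolding radial_integral_def by simp

lemma radial_integral_norm_square:
  fixes f :: "real^'n::finite \<Rightarrow> real"
  shows "radial_integral p (\<lambda>x. (norm x)\<^sup>2 * f x) = radial_integral (p + 2) f"
  unfolding radial_integral_def
proof (rule Bochner_Integration.integral_cong[OF refl])
  fix x :: "real^'n"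
  show "norm x powr p * ((norm x)\<^sup>2 * f x) = norm x powr (p + 2) * f x"
    by (cases "x = 0") (simp_all add: powr_add)
qed

text \<open>The weight may be singular at 0, but \<open>F\<close> vanishes on a ball around it, so
  the product-rule formula \<open>?D\<close> is the derivative of weight times \<open>F\<close> at
  every point; its integral along an axis is 0.\<close>

lemma radial_integral_pd:
  fixes F :: "real^'n::finite \<Rightarrow> real"
  assumes F: "punctured_test F"
  shows "radial_integral p (pd k F) = - p * radial_integral (p - 2) (\<lambda>x. x $ k * F x)"
proof -
  let ?G = "\<lambda>x. norm x powr p * F x"
  let ?D = "\<lambda>x v. norm x powr p * frechet_derivative F (at x) v + p * (norm x powr (p - 2) * ((x \<bullet> v) * F x))"
  obtain a b where ab: "0 < a" "\<And>x. norm x < a \<Longrightarrow> F x = 0" "\<And>x. b < norm x \<Longrightarrow> F x = 0"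
    using punctured_testE[OF F] by metis
  have dF: "(F has_derivative frechet_derivative F (at x)) (at x)" for x
    using F by (simp add: punctured_test_smooth smooth_has_derivative)
  have D: "(?G has_derivative ?D x) (at x)" for x
  proof (cases "x = 0")
    case True
    have nb: "\<forall>y\<in>ball 0 a. F y = 0" using ab(2) by simp
    have "(F has_derivative (\<lambda>v. 0)) (at 0)"
      using ab(1) nb by (intro has_derivative_transform_within_open[OF has_derivative_const, of "ball 0 a" 0 0]) auto
    moreover have "(?G has_derivative (\<lambda>v. 0)) (at 0)"
      using ab(1) nb by (intro has_derivative_transform_within_open[OF has_derivative_const, of "ball 0 a" 0 0]) auto
    ultimately show ?thesis using True by (simp add: frechet_derivative_at[symmetric])
  next
    case False
    have "((\<lambda>x. norm x powr p) has_derivative (\<lambda>v. p * norm x powr (p - 2) * (x \<bullet> v))) (at x)"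
    proof -
      have "((\<lambda>r. r powr p) has_derivative (\<lambda>t. (p * norm x powr (p - 1)) * t)) (at (norm x))"
        using has_real_derivative_powr[of "norm x" p] False
        by (simp add: has_field_derivative_def)
      from has_derivative_compose[OF has_derivative_norm[OF False] this]
      have "((\<lambda>x. norm x powr p) has_derivative (\<lambda>v. (p * norm x powr (p - 1)) * (v \<bullet> sgn x))) (at x)"
        by simp
      also have "(\<lambda>v. (p * norm x powr (p - 1)) * (v \<bullet> sgn x)) = (\<lambda>v. p * norm x powr (p - 2) * (x \<bullet> v))"
      proof
        fix v
        have "norm x powr (p - 1) = norm x powr (p - 2) * norm x"
          using False powr_add[of "norm x" "p - 2" 1] by simp
        then show "(p * norm x powr (p - 1)) * (v \<bullet> sgn x) = p * norm x powr (p - 2) * (x \<bullet> v)"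
          using False by (simp add: sgn_div_norm inner_commute)
      qed
      finally show ?thesis .
    qed
    from has_derivative_mult[OF this dF[of x]] show ?thesis by (simp add: mult.assoc)
  qed
  have fD: "frechet_derivative ?G (at x) = ?D x" for x
    using frechet_derivative_at[OF D] by simp
  have k: "?D x (axis k 1) = norm x powr p * pd k F x + p * (norm x powr (p - 2) * (x $ k * F x))" for x
    by (simp add: pd_def inner_axis)
  have pt: "punctured_test (pd k F)" "punctured_test (\<lambda>x. x $ k * F x)"
    using F by (auto intro: punctured_test_pd punctured_test_mult_left)
  have "(LINT x|lborel. frechet_derivative ?G (at x) (axis k 1)) = 0"
  proof (rule integral_directional_derivative_eq_0)
    show "?G differentiable (at x)" for x using D differentiable_def by blast
    show "continuous_on UNIV (\<lambda>x. frechet_derivative ?G (at x) (axis k 1))"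
      unfolding fD k using pt
      by (intro continuous_on_add continuous_on_mult[OF continuous_on_const]
          continuous_on_powr_mult_punctured_test)
    show "?G x = 0" if "b < norm x" for x using ab(3)[OF that] by simp
  qed
  then show ?thesis
    unfolding fD k radial_integral_def using pt by (simp add: integrable_powr_mult_punctured_test)
qed

lemma radial_integral_divergence:
  assumes "\<And>k. punctured_test (F k)"
  shows "radial_integral p (\<lambda>x. \<Sum>k\<in>UNIV. pd k (F k) x) =
    - p * radial_integral (p - 2) (\<lambda>x. \<Sum>k\<in>UNIV. x $ k * F k x)"
  using assms
  by (simp add: radial_integral_sum punctured_test_pd punctured_test_mult_left smooth_component
      radial_integral_pd sum_distrib_left)

section \<open>Euler field and spherical Laplacian\<close>

definition euler :: "(real^'n::finite \<Rightarrow> real) \<Rightarrow> real^'n \<Rightarrow> real"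
  where "euler f x = (\<Sum>k\<in>UNIV. x $ k * pd k f x)"

definition lap :: "(real^'n::finite \<Rightarrow> real) \<Rightarrow> real^'n \<Rightarrow> real"
  where "lap f x = (\<Sum>k\<in>UNIV. pd k (pd k f) x)"

text \<open>On the unit sphere, the next two operators are the Laplace--Beltrami operator and the
  inner product of the tangential gradients.\<close>

definition spherical_lap :: "(real^'n::finite \<Rightarrow> real) \<Rightarrow> real^'n \<Rightarrow> real"
  where "spherical_lap f x =
    (norm x)\<^sup>2 * lap f x - euler (euler f) x - (real CARD('n) - 2) * euler f x"

definition spherical_inner :: "(real^'n::finite \<Rightarrow> real) \<Rightarrow> (real^'n \<Rightarrow> real) \<Rightarrow> real^'n \<Rightarrow> real"
  where "spherical_inner f g x =
    (norm x)\<^sup>2 * (\<Sum>k\<in>UNIV. pd k f x * pd k g x) - euler f x * euler g x"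

lemma smooth_euler: "smooth f \<Longrightarrow> smooth (euler f)"
  unfolding euler_def[abs_def] by (simp add: smooth_simps)

lemma smooth_lap: "smooth f \<Longrightarrow> smooth (lap f)"
  unfolding lap_def[abs_def] by (simp add: smooth_simps)

lemma smooth_spherical_lap: "smooth f \<Longrightarrow> smooth (spherical_lap f)"
  unfolding spherical_lap_def[abs_def] by (simp add: smooth_simps smooth_euler smooth_lap)

lemma smooth_spherical_inner: "smooth f \<Longrightarrow> smooth g \<Longrightarrow> smooth (spherical_inner f g)"
  unfolding spherical_inner_def[abs_def] by (simp add: smooth_simps smooth_euler)

lemmas smooth_op_simps = smooth_simps smooth_euler smooth_lap smooth_spherical_lap smooth_spherical_inner
  punctured_test_smooth

lemma punctured_test_euler: "punctured_test f \<Longrightarrow> punctured_test (euler f)"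
  unfolding euler_def[abs_def] by (simp add: punctured_test_simps smooth_simps)

lemma punctured_test_lap: "punctured_test f \<Longrightarrow> punctured_test (lap f)"
  unfolding lap_def[abs_def] by (simp add: punctured_test_simps smooth_simps)

lemma punctured_test_spherical_lap: "punctured_test f \<Longrightarrow> punctured_test (spherical_lap f)"
  unfolding spherical_lap_def[abs_def]
  by (simp add: punctured_test_simps smooth_simps punctured_test_euler punctured_test_lap)

lemma punctured_test_spherical_inner:
  assumes "punctured_test f" "punctured_test g"
  shows "punctured_test (spherical_inner f g)"
  unfolding spherical_inner_def[abs_def]
  using assms by (simp add: punctured_test_simps smooth_op_simps punctured_test_euler)

lemmas punctured_test_op_simps = punctured_test_simps punctured_test_euler punctured_test_lap
  punctured_test_spherical_lap punctured_test_spherical_inner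

lemma sum_square_component: "(\<Sum>k\<in>UNIV. x $ k * x $ k) = (norm (x::real^'n::finite))\<^sup>2"
  by (simp add: power2_norm_eq_inner inner_vec_def)

lemma euler_const: "euler (\<lambda>x. c) x = 0"
  by (simp add: euler_def pd_const)

lemma euler_norm_square: "euler (\<lambda>x. (norm x)\<^sup>2) x = 2 * (norm x)\<^sup>2"
  by (simp add: euler_def pd_norm_square mult.left_commute[of _ 2] sum_square_component
      flip: sum_distrib_left)

lemma euler_add: "smooth f \<Longrightarrow> smooth g \<Longrightarrow> euler (\<lambda>x. f x + g x) x = euler f x + euler g x"
  by (simp add: euler_def pd_add distrib_left sum.distrib)

lemma euler_diff: "smooth f \<Longrightarrow> smooth g \<Longrightarrow> euler (\<lambda>x. f x - g x) x = euler f x - euler g x"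
  by (simp add: euler_def pd_diff right_diff_distrib sum_subtractf)

lemma euler_mult:
  "smooth f \<Longrightarrow> smooth g \<Longrightarrow> euler (\<lambda>x. f x * g x) x = f x * euler g x + euler f x * g x"
  by (simp add: euler_def pd_mult distrib_left sum.distrib sum_distrib_left sum_distrib_right mult_ac)

lemma euler_sum:
  assumes "\<And>j. j \<in> I \<Longrightarrow> smooth (f j)"
  shows "euler (\<lambda>x. \<Sum>j\<in>I. f j x) x = (\<Sum>j\<in>I. euler (f j) x)"
proof -
  have "euler (\<lambda>x. \<Sum>j\<in>I. f j x) x = (\<Sum>k\<in>UNIV. \<Sum>j\<in>I. x $ k * pd k (f j) x)"
    by (simp add: euler_def pd_sum assms sum_distrib_left)
  also have "\<dots> = (\<Sum>j\<in>I. euler (f j) x)"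
    unfolding euler_def by (rule sum.swap)
  finally show ?thesis .
qed

lemmas euler_simps = euler_const euler_norm_square euler_add euler_diff euler_mult euler_sum

text \<open>The extra \<open>pd k f\<close> comes from differentiating the coefficient
  \<open>x $ k\<close> of the Euler field; the rest is symmetry of second derivatives.\<close>

lemma pd_euler: "smooth f \<Longrightarrow> pd k (euler f) x = pd k f x + euler (pd k f) x"
  unfolding euler_def[abs_def]
  by (simp add: pd_simps smooth_simps sum.distrib pd_commute[of f k] if_distrib[of "\<lambda>a. a * _"]
      add.commute cong: if_cong)

lemma pd_euler': "smooth f \<Longrightarrow> pd k (euler f) = (\<lambda>x. pd k f x + euler (pd k f) x)"
  by (rule ext) (rule pd_euler)

lemma euler_pd_eq_sum: "smooth f \<Longrightarrow> euler (pd k f) x = (\<Sum>j\<in>UNIV. x $ j * pd k (pd j f) x)"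
  by (simp add: euler_def pd_commute[of f k])

lemma euler_euler_eq_sum: "euler (euler f) x = (\<Sum>k\<in>UNIV. x $ k * pd k (euler f) x)"
  by (simp add: euler_def)

lemma lap_euler:
  assumes "smooth f"
  shows "lap (euler f) x = euler (lap f) x + 2 * lap f x"
proof -
  have "pd k (pd k (euler f)) x = 2 * pd k (pd k f) x + euler (pd k (pd k f)) x" for k
    using assms by (simp add: pd_euler' pd_simps smooth_op_simps)
  then have "lap (euler f) x = 2 * lap f x + (\<Sum>k\<in>UNIV. euler (pd k (pd k f)) x)"
    by (simp add: lap_def sum.distrib sum_distrib_left)
  also have "(\<Sum>k\<in>UNIV. euler (pd k (pd k f)) x) = euler (lap f) x"
    using assms unfolding lap_def[abs_def] by (simp add: euler_sum smooth_simps)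
  finally show ?thesis by simp
qed

text \<open>\<open>lap\<close> lowers the degree of homogeneity by two and
  \<open>(norm x)\<^sup>2\<close> raises it by two, so \<open>spherical_lap\<close> preserves the
  degree and commutes with the Euler field.\<close>

lemma euler_spherical_lap:
  assumes "smooth f"
  shows "euler (spherical_lap f) x = spherical_lap (euler f) x"
  using assms unfolding spherical_lap_def[abs_def]
  by (simp add: euler_simps smooth_op_simps lap_euler algebra_simps)

lemma euler_spherical_inner:
  assumes "smooth f" "smooth g"
  shows "euler (spherical_inner f g) x = spherical_inner (euler f) g x + spherical_inner f (euler g) x"
  using assms unfolding spherical_inner_def[abs_def]
  by (simp add: euler_simps smooth_op_simps pd_euler algebra_simps sum.distrib)

lemma spherical_inner_commute: "spherical_inner f g x = spherical_inner g f x"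
  by (simp add: spherical_inner_def mult.commute)

lemma spherical_inner_add_cmult:
  assumes "smooth f" "smooth g" "smooth h"
  shows "spherical_inner (\<lambda>x. f x + c * g x) h x = spherical_inner f h x + c * spherical_inner g h x"
  using assms
  by (simp add: spherical_inner_def pd_simps euler_simps smooth_simps algebra_simps sum.distrib
      sum_distrib_left)

lemma spherical_inner_nonneg: "0 \<le> spherical_inner f f x"
proof -
  define g where "g = (\<chi> k. pd k f x)"
  have "(x \<bullet> g)\<^sup>2 \<le> (x \<bullet> x) * (g \<bullet> g)" by (rule Cauchy_Schwarz_ineq)
  moreover have "x \<bullet> g = euler f x" "g \<bullet> g = (\<Sum>k\<in>UNIV. pd k f x * pd k f x)"
    by (simp_all add: g_def inner_vec_def euler_def)
  ultimately show ?thesis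
    by (simp add: spherical_inner_def power2_norm_eq_inner power2_eq_square[of "euler f x"])
qed

text \<open>The field \<open>F\<close> is \<open>g\<close> times \<open>(norm x)\<^sup>2\<close>
  times the tangential part of the gradient of \<open>f\<close>. It is orthogonal to
  \<open>x\<close>, so the radial weight contributes nothing, and its divergence is the sum of the
  two integrands.\<close>

lemma spherical_lap_by_parts:
  fixes f g :: "real^'n::finite \<Rightarrow> real"
  assumes f: "smooth f" and g: "punctured_test g"
  shows "radial_integral p (\<lambda>x. spherical_lap f x * g x) = - radial_integral p (spherical_inner f g)"
proof -
  have g': "smooth g" using g by (rule punctured_test_smooth)
  define F where "F k x = ((norm x)\<^sup>2 * pd k f x - x $ k * euler f x) * g x" for k and x :: "real^'n"
  have "pd k (F k) x = (x $ k * pd k f x * 2 + (norm x)\<^sup>2 * pd k (pd k f) x - euler f x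
      - x $ k * pd k (euler f) x) * g x + (norm x)\<^sup>2 * (pd k f x * pd k g x)
      - euler f x * (x $ k * pd k g x)" for k x
    using f g' unfolding F_def[abs_def] by (simp add: pd_simps smooth_op_simps algebra_simps)
  then have "(\<Sum>k\<in>UNIV. pd k (F k) x) = (2 * euler f x + (norm x)\<^sup>2 * lap f x - real CARD('n) * euler f x
      - euler (euler f) x) * g x + spherical_inner f g x" for x
    by (simp add: sum.distrib sum_subtractf flip: sum_distrib_left sum_distrib_right)
      (simp add: euler_def[of f] euler_def[of g] euler_euler_eq_sum lap_def spherical_inner_def
        flip: sum_distrib_right)
  then have div: "(\<Sum>k\<in>UNIV. pd k (F k) x) = spherical_lap f x * g x + spherical_inner f g x" for x
    by (simp add: spherical_lap_def algebra_simps)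
  have "x $ k * F k x = ((norm x)\<^sup>2 * g x) * (x $ k * pd k f x) - (euler f x * g x) * (x $ k * x $ k)" for k x
    by (simp add: F_def algebra_simps)
  then have "(\<Sum>k\<in>UNIV. x $ k * F k x) = 0" for x
    by (simp add: sum_subtractf sum_square_component flip: sum_distrib_left euler_def)
  moreover have "punctured_test (F k)" for k
    using f g unfolding F_def[abs_def] by (simp add: punctured_test_simps smooth_op_simps)
  ultimately have "radial_integral p (\<lambda>x. spherical_lap f x * g x + spherical_inner f g x) = 0"
    using radial_integral_divergence[of F p] by (simp add: div radial_integral_def)
  moreover have "punctured_test (spherical_inner f g)"
    using f g g' unfolding spherical_inner_def[abs_def]
    by (simp add: punctured_test_op_simps smooth_op_simps)
  ultimately show ?thesis
    using f g by (simp add: radial_integral_add punctured_test_op_simps smooth_op_simps)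
qed

text \<open>Divergence theorem for the field \<open>x h\<close>: its divergence supplies
  \<open>CARD('n)\<close>, the weight supplies \<open>p\<close>.\<close>

lemma radial_integral_euler:
  fixes h :: "real^'n::finite \<Rightarrow> real"
  assumes h: "punctured_test h"
  shows "radial_integral p (euler h) = - (p + real CARD('n)) * radial_integral p h"
proof -
  have "(\<Sum>k\<in>UNIV. pd k (\<lambda>x. x $ k * h x) x) = euler h x + real CARD('n) * h x" for x
    using punctured_test_smooth[OF h] by (simp add: pd_simps smooth_simps euler_def sum.distrib)
  moreover have "(\<Sum>k\<in>UNIV. x $ k * (x $ k * h x)) = (norm x)\<^sup>2 * h x" for x
    by (simp add: mult.assoc[symmetric] sum_square_component flip: sum_distrib_right)
  ultimately have "radial_integral p (\<lambda>x. euler h x + real CARD('n) * h x) = - p * radial_integral p h"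
    using radial_integral_divergence[of "\<lambda>k x. x $ k * h x" p] h
    by (simp add: punctured_test_simps smooth_simps radial_integral_norm_square)
  moreover have "radial_integral p (\<lambda>x. euler h x + real CARD('n) * h x)
      = radial_integral p (euler h) + real CARD('n) * radial_integral p h"
    using h by (simp add: radial_integral_add radial_integral_cmult punctured_test_op_simps punctured_test_cmult)
  ultimately show ?thesis by (simp add: algebra_simps)
qed

text \<open>In the logarithmic variable \<open>t = ln \<bar>x\<bar>\<close> this is \<open>d/dt\<close> after the weight has been absorbed.\<close>

definition skew_euler :: "real \<Rightarrow> (real^'n::finite \<Rightarrow> real) \<Rightarrow> real^'n \<Rightarrow> real"
  where "skew_euler p f x = euler f x + (p + real CARD('n)) / 2 * f x"

lemma punctured_test_skew_euler: "punctured_test f \<Longrightarrow> punctured_test (skew_euler p f)"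
  unfolding skew_euler_def[abs_def]
  by (intro punctured_test_add punctured_test_euler punctured_test_cmult)

text \<open>\<open>euler (f g) + (p + n) f g\<close> integrates to 0. By the Leibniz rule it splits
  evenly between the two factors, which is the origin of the constant \<open>(p + n) / 2\<close> in
  the shift.\<close>

lemma radial_integral_skew_euler:
  assumes "punctured_test f" "punctured_test g"
  shows "radial_integral p (\<lambda>x. skew_euler p f x * g x) = - radial_integral p (\<lambda>x. f x * skew_euler p g x)"
proof -
  have s: "smooth f" "smooth g" using assms by (simp_all add: punctured_test_smooth)
  have "radial_integral p (\<lambda>x. euler (\<lambda>x. f x * g x) x + (p + real CARD('a)) * (f x * g x)) = 0"
    using assms s by (simp add: radial_integral_add radial_integral_cmult radial_integral_euler[of "\<lambda>x. f x * g x"]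
      punctured_test_op_simps punctured_test_cmult smooth_simps flip: distrib_right)
  also have "(\<lambda>x. euler (\<lambda>x. f x * g x) x + (p + real CARD('a)) * (f x * g x)) =
      (\<lambda>x. skew_euler p f x * g x + f x * skew_euler p g x)"
    using s by (auto simp: euler_mult skew_euler_def algebra_simps)
  finally show ?thesis
    using assms by (simp add: radial_integral_add punctured_test_simps punctured_test_skew_euler punctured_test_smooth)
qed

text \<open>Same argument with \<open>spherical_inner f g\<close> in place of the product, since
  \<open>euler\<close> satisfies a Leibniz rule for it as well.\<close>

lemma radial_integral_spherical_inner_skew_euler:
  assumes "punctured_test f" "punctured_test g"
  shows "radial_integral p (spherical_inner (skew_euler p f) g) =
    - radial_integral p (spherical_inner f (skew_euler p g))"
proof -
  let ?c = "(p + real CARD('a)) / 2"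
  have s: "smooth f" "smooth g" using assms by (simp_all add: punctured_test_smooth)
  have 1: "spherical_inner (skew_euler p f) g x = spherical_inner (euler f) g x + ?c * spherical_inner f g x"
    if "smooth f" "smooth g" for f g :: "real^'a \<Rightarrow> real" and x
    unfolding skew_euler_def[abs_def]
    using that by (intro spherical_inner_add_cmult smooth_euler)
  have "radial_integral p (\<lambda>x. euler (spherical_inner f g) x + (p + real CARD('a)) * spherical_inner f g x) = 0"
    using assms by (simp add: radial_integral_add radial_integral_cmult radial_integral_euler
        punctured_test_op_simps punctured_test_cmult flip: distrib_right)
  also have "(\<lambda>x. euler (spherical_inner f g) x + (p + real CARD('a)) * spherical_inner f g x) =
      (\<lambda>x. spherical_inner (skew_euler p f) g x + spherical_inner f (skew_euler p g) x)"
  proof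
    fix x
    show "euler (spherical_inner f g) x + (p + real CARD('a)) * spherical_inner f g x =
      spherical_inner (skew_euler p f) g x + spherical_inner f (skew_euler p g) x"
      unfolding euler_spherical_inner[OF s] spherical_inner_commute[of f "skew_euler p g"]
        spherical_inner_commute[of f "euler g"] 1[OF s] 1[OF s(2,1)] spherical_inner_commute[of g f]
      by (simp add: field_simps)
  qed
  finally show ?thesis
    using assms by (simp add: radial_integral_add punctured_test_op_simps punctured_test_skew_euler)
qed

section \<open>Bochner's identity on the sphere\<close>

lemma pd_lap:
  assumes "smooth f"
  shows "pd k (lap f) x = lap (pd k f) x"
proof -
  have "pd k (pd j (pd j f)) = pd j (pd j (pd k f))" for j
    using pd_commute[of "pd j f" k j] pd_commute[of f k j] assms by (simp add: smooth_pd)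
  then show ?thesis
    using assms unfolding lap_def[abs_def] by (simp add: pd_sum smooth_simps)
qed

text \<open>The three terms of the commutator, paired with \<open>pd k f\<close> and summed over
  \<open>k\<close>, are the middle bracket of \<open>spherical_gamma2\<close>.\<close>

lemma pd_spherical_lap:
  fixes f :: "real^'n::finite \<Rightarrow> real"
  assumes "smooth f"
  shows "pd k (spherical_lap f) x = spherical_lap (pd k f) x + 2 * (x $ k * lap f x)
    - 2 * euler (pd k f) x - (real CARD('n) - 1) * pd k f x"
  using assms unfolding spherical_lap_def[abs_def]
  by (simp add: pd_simps smooth_op_simps pd_euler pd_lap euler_simps pd_euler' algebra_simps)

text \<open>Applied with the Hessian for \<open>h\<close>: the tangential part of \<open>h\<close> lives on a space of dimension
  \<open>n - 1\<close>, which improves the constant in \<open>(tr h)\<^sup>2 \<le> n * \<bar>h\<bar>\<^sup>2\<close>.\<close>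

lemma tangential_trace_inequality:
  fixes x q :: "'n::finite \<Rightarrow> real" and h :: "'n \<Rightarrow> 'n \<Rightarrow> real"
  assumes sym: "\<And>i j. h i j = h j i" and q: "\<And>i. q i = (\<Sum>j\<in>UNIV. x j * h i j)"
    and R: "R = (\<Sum>i\<in>UNIV. x i * x i)" and Q: "Q = (\<Sum>i\<in>UNIV. x i * q i)"
    and n: "CARD('n) \<ge> 2"
  shows "(R * (\<Sum>i\<in>UNIV. h i i) - Q)\<^sup>2 / (real CARD('n) - 1) \<le>
    R\<^sup>2 * (\<Sum>i\<in>UNIV. \<Sum>j\<in>UNIV. (h i j)\<^sup>2) - 2 * R * (\<Sum>i\<in>UNIV. (q i)\<^sup>2) + Q\<^sup>2"
proof (cases "R = 0")
  case True
  then have "x i = 0" for i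
    using R by (simp add: sum_nonneg_eq_0_iff)
  then show ?thesis using True Q by simp
next
  case False
  define H where "H = (\<Sum>i\<in>UNIV. \<Sum>j\<in>UNIV. (h i j)\<^sup>2)"
  define N where "N = (\<Sum>i\<in>UNIV. (q i)\<^sup>2)"
  define tr where "tr = (\<Sum>i\<in>UNIV. h i i)"
  define r where "r i = (\<Sum>j\<in>UNIV. h i j * q j)" for i
  define t where "t = (R * tr - Q) / (real CARD('n) - 1)"
  define c where "c = (Q + t) / R"
  \<comment> \<open>With \<open>P\<close> the orthogonal projection onto the complement of
    \<open>x\<close>, \<open>S\<close> is \<open>R\<close> times the trace-free part of
    \<open>P h P\<close>. Here \<open>t\<close> is the trace of \<open>R P h P\<close> divided by
    the dimension \<open>n - 1\<close>, and \<open>c\<close> collects the coefficients of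
    \<open>x i * x j\<close> from \<open>R P h P\<close> and from \<open>- t P\<close>. The claim is
    that the squared norm of \<open>S\<close> is nonnegative.\<close>
  define S where "S i j = R * h i j - x i * q j - q i * x j - (if i = j then t else 0) + c * x i * x j" for i j
  have xr: "(\<Sum>i\<in>UNIV. x i * r i) = N"
  proof -
    have "(\<Sum>i\<in>UNIV. x i * r i) = (\<Sum>i\<in>UNIV. \<Sum>j\<in>UNIV. q j * (x i * h j i))"
      by (simp add: r_def sum_distrib_left mult_ac sym)
    also have "\<dots> = (\<Sum>j\<in>UNIV. q j * q j)"
      by (subst sum.swap) (simp add: q[symmetric] flip: sum_distrib_left)
    finally show ?thesis by (simp add: N_def power2_eq_square)
  qed
  \<comment> \<open>Sorted by the dependence on \<open>j\<close>: after summation only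
    \<open>r i\<close>, \<open>q i\<close>, \<open>N\<close>, \<open>Q\<close> and \<open>R\<close>
    appear, and the conditional term contributes at \<open>j = i\<close> alone.\<close>
  have sq: "(S i j)\<^sup>2 = R\<^sup>2 * (h i j)\<^sup>2 - (2 * R * x i) * (h i j * q j) - (2 * R * q i) * (x j * h i j)
      + (2 * R * c * x i) * (x j * h i j) + (x i)\<^sup>2 * (q j)\<^sup>2 + (2 * x i * q i - 2 * c * (x i)\<^sup>2) * (x j * q j)
      + ((q i)\<^sup>2 - 2 * c * x i * q i + c\<^sup>2 * (x i)\<^sup>2) * (x j * x j)
      + (if i = j then t\<^sup>2 - 2 * R * t * h i j + 2 * t * (x i * q j + q i * x j) - 2 * t * c * x i * x j else 0)"
    for i j
    by (cases "i = j") (auto simp: S_def power2_eq_square algebra_simps)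
  have inner: "(\<Sum>j\<in>UNIV. (S i j)\<^sup>2) = R\<^sup>2 * (\<Sum>j\<in>UNIV. (h i j)\<^sup>2) - (2 * R * x i) * r i - (2 * R * q i) * q i
      + (2 * R * c * x i) * q i + (x i)\<^sup>2 * N + (2 * x i * q i - 2 * c * (x i)\<^sup>2) * Q
      + ((q i)\<^sup>2 - 2 * c * x i * q i + c\<^sup>2 * (x i)\<^sup>2) * R
      + (t\<^sup>2 - 2 * R * t * h i i + 2 * t * (x i * q i + q i * x i) - 2 * t * c * x i * x i)" for i
    unfolding sq
    by (simp only: sum.distrib sum_subtractf flip: sum_distrib_left)
      (simp add: r_def[symmetric] q[symmetric] N_def[symmetric] Q[symmetric] R[symmetric])
  have inner': "(\<Sum>j\<in>UNIV. (S i j)\<^sup>2) = R\<^sup>2 * (\<Sum>j\<in>UNIV. (h i j)\<^sup>2) - (2 * R) * (x i * r i) - R * (q i)\<^sup>2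
      + (2 * Q + 4 * t) * (x i * q i) + (N - 2 * c * Q + c\<^sup>2 * R - 2 * t * c) * (x i * x i)
      + t\<^sup>2 - (2 * R * t) * h i i" for i
    unfolding inner by (simp add: power2_eq_square algebra_simps)
  have "(\<Sum>i\<in>UNIV. \<Sum>j\<in>UNIV. (S i j)\<^sup>2) = R\<^sup>2 * H - 2 * R * N - R * N
      + (2 * Q + 4 * t) * Q + (N - 2 * c * Q + c\<^sup>2 * R - 2 * t * c) * R
      + real CARD('n) * t\<^sup>2 - (2 * R * t) * tr"
    unfolding inner'
    by (simp only: sum.distrib sum_subtractf flip: sum_distrib_left)
      (simp add: H_def[symmetric] N_def[symmetric] tr_def[symmetric] Q[symmetric] R[symmetric] xr)
  also have "\<dots> = R\<^sup>2 * H - 2 * R * N + 2 * Q\<^sup>2 + 4 * t * Q - 2 * (c * R) * (Q + t) + (c * R)\<^sup>2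
      + real CARD('n) * t\<^sup>2 - 2 * R * t * tr"
    by (simp add: power2_eq_square algebra_simps)
  also have "c * R = Q + t" using False by (simp add: c_def)
  also have "R\<^sup>2 * H - 2 * R * N + 2 * Q\<^sup>2 + 4 * t * Q - 2 * (Q + t) * (Q + t) + (Q + t)\<^sup>2
      + real CARD('n) * t\<^sup>2 - 2 * R * t * tr
      = R\<^sup>2 * H - 2 * R * N + Q\<^sup>2 + ((real CARD('n) - 1) * t) * t - 2 * t * (R * tr - Q)"
    by (simp add: power2_eq_square algebra_simps)
  also have "(real CARD('n) - 1) * t = R * tr - Q" using n by (simp add: t_def)
  also have "R\<^sup>2 * H - 2 * R * N + Q\<^sup>2 + (R * tr - Q) * t - 2 * t * (R * tr - Q)
      = R\<^sup>2 * H - 2 * R * N + Q\<^sup>2 - (R * tr - Q)\<^sup>2 / (real CARD('n) - 1)"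
    by (simp add: t_def power2_eq_square)
  finally have "(\<Sum>i\<in>UNIV. \<Sum>j\<in>UNIV. (S i j)\<^sup>2) =
      R\<^sup>2 * H - 2 * R * N + Q\<^sup>2 - (R * tr - Q)\<^sup>2 / (real CARD('n) - 1)" .
  moreover have "0 \<le> (\<Sum>i\<in>UNIV. \<Sum>j\<in>UNIV. (S i j)\<^sup>2)"
    by (intro sum_nonneg) simp
  ultimately show ?thesis by (simp add: H_def N_def tr_def)
qed

text \<open>Bakry's iterated carre du champ \<open>\<Gamma>\<^sub>2\<close> of the sphere, expanded so that the
  third derivatives of \<open>f\<close> cancel.\<close>

definition spherical_gamma2 :: "(real^'n::finite \<Rightarrow> real) \<Rightarrow> real^'n \<Rightarrow> real"
  where "spherical_gamma2 f x = (norm x)\<^sup>2 * (\<Sum>k\<in>UNIV. spherical_inner (pd k f) (pd k f) x)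
    - (norm x)\<^sup>2 * (2 * (euler f x * lap f x) - 2 * (\<Sum>k\<in>UNIV. pd k f x * euler (pd k f) x)
        - (real CARD('n) - 1) * (\<Sum>k\<in>UNIV. pd k f x * pd k f x))
    - spherical_inner (euler f) (euler f) x"

text \<open>One integration by parts turns the right-hand side into minus the pairing of
  \<open>f\<close> with \<open>spherical_lap f\<close>. There \<open>spherical_lap\<close> is
  commuted with \<open>pd k\<close> and with \<open>euler\<close>, and a second integration by parts
  is applied to each \<open>pd k f\<close> and to \<open>euler f\<close>.\<close>

lemma radial_integral_spherical_gamma2:
  fixes f :: "real^'n::finite \<Rightarrow> real"
  assumes f: "punctured_test f"
  shows "radial_integral p (spherical_gamma2 f) = radial_integral p (\<lambda>x. spherical_lap f x * spherical_lap f x)"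
proof -
  note simps = punctured_test_op_simps smooth_op_simps
  let ?W = "\<lambda>x. (norm x)\<^sup>2 * (2 * (euler f x * lap f x) - 2 * (\<Sum>k\<in>UNIV. pd k f x * euler (pd k f) x)
        - (real CARD('n) - 1) * (\<Sum>k\<in>UNIV. pd k f x * pd k f x))"
  have s: "smooth f" using f by (rule punctured_test_smooth)
  have "spherical_inner f (spherical_lap f) x =
      (norm x)\<^sup>2 * (\<Sum>k\<in>UNIV. spherical_lap (pd k f) x * pd k f x) + ?W x
      - spherical_lap (euler f) x * euler f x" for x
  proof -
    have "pd k f x * pd k (spherical_lap f) x = spherical_lap (pd k f) x * pd k f x
      + (2 * lap f x) * (x $ k * pd k f x) - 2 * (pd k f x * euler (pd k f) x)
      - (real CARD('n) - 1) * (pd k f x * pd k f x)" for k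
      by (simp add: pd_spherical_lap[OF s] algebra_simps)
    then have sum_eq: "(\<Sum>k\<in>UNIV. pd k f x * pd k (spherical_lap f) x) =
      (\<Sum>k\<in>UNIV. spherical_lap (pd k f) x * pd k f x) + 2 * lap f x * euler f x
      - 2 * (\<Sum>k\<in>UNIV. pd k f x * euler (pd k f) x)
      - (real CARD('n) - 1) * (\<Sum>k\<in>UNIV. pd k f x * pd k f x)"
      by (simp only: sum.distrib sum_subtractf euler_def[of f] flip: sum_distrib_left)
    then show ?thesis
      unfolding spherical_inner_def[of f] sum_eq euler_spherical_lap[OF s]
      by (simp add: algebra_simps)
  qed
  then have "radial_integral p (spherical_inner f (spherical_lap f)) =
      radial_integral p (\<lambda>x. (norm x)\<^sup>2 * (\<Sum>k\<in>UNIV. spherical_lap (pd k f) x * pd k f x) + ?W x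
      - spherical_lap (euler f) x * euler f x)"
    by (intro arg_cong[where f = "radial_integral p"] ext)
  also have "\<dots> = radial_integral p (\<lambda>x. (norm x)\<^sup>2 * (\<Sum>k\<in>UNIV. spherical_lap (pd k f) x * pd k f x))
      + radial_integral p ?W - radial_integral p (\<lambda>x. spherical_lap (euler f) x * euler f x)"
    using f by (simp add: radial_integral_diff radial_integral_add simps)
  also have "radial_integral p (\<lambda>x. (norm x)\<^sup>2 * (\<Sum>k\<in>UNIV. spherical_lap (pd k f) x * pd k f x)) =
      - radial_integral p (\<lambda>x. (norm x)\<^sup>2 * (\<Sum>k\<in>UNIV. spherical_inner (pd k f) (pd k f) x))"
    unfolding radial_integral_norm_square
    using f by (simp add: radial_integral_sum simps spherical_lap_by_parts sum_negf)
  also have "radial_integral p (\<lambda>x. spherical_lap (euler f) x * euler f x) =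
      - radial_integral p (spherical_inner (euler f) (euler f))"
    using f by (intro spherical_lap_by_parts) (simp_all add: simps)
  finally have "- radial_integral p (spherical_inner f (spherical_lap f)) =
      radial_integral p (\<lambda>x. (norm x)\<^sup>2 * (\<Sum>k\<in>UNIV. spherical_inner (pd k f) (pd k f) x))
      - radial_integral p ?W - radial_integral p (spherical_inner (euler f) (euler f))"
    by simp
  also have "\<dots> = radial_integral p (spherical_gamma2 f)"
    unfolding spherical_gamma2_def[abs_def] using f by (simp add: radial_integral_diff simps)
  finally show ?thesis
    using f by (simp add: spherical_lap_by_parts simps)
qed

text \<open>The curvature-dimension inequality of the unit sphere, which has dimension
  \<open>n - 1\<close> and Ricci curvature \<open>n - 2\<close>. The Hessian terms are estimated by
  \<open>tangential_trace_inequality\<close>; everything else is an identity.\<close>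

lemma spherical_gamma2_ge:
  fixes f :: "real^'n::finite \<Rightarrow> real"
  assumes s: "smooth f" and n: "CARD('n) \<ge> 2"
  shows "(real CARD('n) - 2) * spherical_inner f f x + (spherical_lap f x)\<^sup>2 / (real CARD('n) - 1)
    \<le> spherical_gamma2 f x"
proof -
  define h where "h i j = pd i (pd j f) x" for i j
  define q where "q i = euler (pd i f) x" for i
  define R where "R = (norm x)\<^sup>2"
  define Q where "Q = (\<Sum>i\<in>UNIV. x $ i * q i)"
  define e where "e = euler f x"
  define H where "H = (\<Sum>i\<in>UNIV. \<Sum>j\<in>UNIV. (h i j)\<^sup>2)"
  define N where "N = (\<Sum>i\<in>UNIV. (q i)\<^sup>2)"
  define G where "G = (\<Sum>k\<in>UNIV. pd k f x * pd k f x)"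
  define B where "B = (\<Sum>k\<in>UNIV. pd k f x * q k)"
  define m where "m = real CARD('n) - 1"
  have m: "m > 0" using n by (simp add: m_def)
  have lap: "lap f x = (\<Sum>i\<in>UNIV. h i i)" by (simp add: lap_def h_def)
  have ee: "euler (euler f) x = Q + e"
    by (simp add: euler_euler_eq_sum pd_euler s distrib_left sum.distrib Q_def q_def e_def euler_def[of f])
  have sph: "spherical_lap f x = R * lap f x - Q - m * e"
    by (simp add: spherical_lap_def ee R_def m_def algebra_simps flip: e_def)
  have tr: "(R * lap f x - Q)\<^sup>2 / m \<le> R\<^sup>2 * H - 2 * R * N + Q\<^sup>2"
    unfolding lap H_def N_def m_def
    by (rule tangential_trace_inequality[where x = "\<lambda>i. x $ i"])
      (simp_all add: h_def q_def R_def Q_def n sum_square_component euler_pd_eq_sum[OF s] pd_commute[OF s])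
  have "(\<Sum>k\<in>UNIV. spherical_inner (pd k f) (pd k f) x) = R * H - N"
  proof -
    have "spherical_inner (pd k f) (pd k f) x = R * (\<Sum>j\<in>UNIV. (h k j)\<^sup>2) - (q k)\<^sup>2" for k
      by (simp add: spherical_inner_def R_def h_def q_def power2_eq_square pd_commute[OF s, of _ k])
    then show ?thesis
      by (simp add: H_def N_def sum_subtractf flip: sum_distrib_left)
  qed
  moreover have "spherical_inner (euler f) (euler f) x = R * (G + 2 * B + N) - (Q + e)\<^sup>2"
    unfolding spherical_inner_def ee
    by (simp add: pd_euler s G_def B_def N_def R_def q_def power2_eq_square algebra_simps sum.distrib
        sum_distrib_left)
  ultimately have "spherical_gamma2 f x = R * (R * H - N) - R * (2 * (e * lap f x) - 2 * B - m * G)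
      - (R * (G + 2 * B + N) - (Q + e)\<^sup>2)"
    by (simp add: spherical_gamma2_def R_def G_def B_def e_def m_def q_def)
  also have "\<dots> = (m - 1) * (R * G - e\<^sup>2) + (R\<^sup>2 * H - 2 * R * N + Q\<^sup>2) - 2 * e * (R * lap f x - Q) + m * e\<^sup>2"
    by (simp add: power2_eq_square algebra_simps)
  also have "\<dots> \<ge> (m - 1) * (R * G - e\<^sup>2) + (R * lap f x - Q)\<^sup>2 / m - 2 * e * (R * lap f x - Q) + m * e\<^sup>2"
    using tr by simp
  \<comment> \<open>The first-order terms complete the square to
    \<open>(spherical_lap f x)\<^sup>2 / m\<close>.\<close>
  also have "(m - 1) * (R * G - e\<^sup>2) + (R * lap f x - Q)\<^sup>2 / m - 2 * e * (R * lap f x - Q) + m * e\<^sup>2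
      = (m - 1) * (R * G - e\<^sup>2) + (R * lap f x - Q - m * e)\<^sup>2 / m"
    using m by (simp add: power2_eq_square field_simps)
  also have "R * G - e\<^sup>2 = spherical_inner f f x"
    by (simp add: spherical_inner_def R_def G_def e_def power2_eq_square)
  finally show ?thesis
    unfolding sph m_def by simp
qed

text \<open>Integrating the pointwise bound gives (n - 2) Y + Z / (n - 1) \<le> Z, hence (n - 2) (n
  - 1) Y \<le> (n - 2) Z. The factor n - 2 can be cancelled only for n > 2; at n = 2 the bound says
  Z \<le> Z.\<close>

lemma spherical_gap_ge_3:
  fixes f :: "real^'n::finite \<Rightarrow> real"
  assumes f: "punctured_test f" and n: "CARD('n) \<ge> 3"
  shows "(real CARD('n) - 1) * radial_integral p (spherical_inner f f)
    \<le> radial_integral p (\<lambda>x. spherical_lap f x * spherical_lap f x)"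
proof -
  let ?m = "real CARD('n) - 1"
  let ?Y = "radial_integral p (spherical_inner f f)"
  let ?Z = "radial_integral p (\<lambda>x. spherical_lap f x * spherical_lap f x)"
  note simps = punctured_test_op_simps smooth_op_simps
  have "radial_integral p (\<lambda>x. (?m - 1) * spherical_inner f f x + 1 / ?m * (spherical_lap f x * spherical_lap f x))
      \<le> radial_integral p (spherical_gamma2 f)"
  proof (rule radial_integral_mono)
    show "punctured_test (\<lambda>x. (?m - 1) * spherical_inner f f x + 1 / ?m * (spherical_lap f x * spherical_lap f x))"
      using f by (intro punctured_test_add punctured_test_cmult) (simp_all add: simps)
    show "punctured_test (spherical_gamma2 f)"
      unfolding spherical_gamma2_def[abs_def] using f by (simp add: simps)
    show "(?m - 1) * spherical_inner f f x + 1 / ?m * (spherical_lap f x * spherical_lap f x) \<le> spherical_gamma2 f x" for x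
      using spherical_gamma2_ge[of f x] f n by (simp add: punctured_test_smooth power2_eq_square)
  qed
  also have "radial_integral p (\<lambda>x. (?m - 1) * spherical_inner f f x + 1 / ?m * (spherical_lap f x * spherical_lap f x))
      = (?m - 1) * ?Y + 1 / ?m * ?Z"
    using f by (subst radial_integral_add)
      (intro punctured_test_cmult, simp add: simps, intro punctured_test_cmult, simp add: simps, simp only: radial_integral_cmult)
  finally have "(?m - 1) * ?Y \<le> ?Z - 1 / ?m * ?Z"
    using f by (simp add: radial_integral_spherical_gamma2)
  moreover have "?m > 1" using n by simp
  ultimately have "(?m - 1) * (?m * ?Y) \<le> (?m - 1) * ?Z"
    by (simp add: field_simps)
  then show ?thesis using \<open>?m > 1\<close> by (simp only: mult_le_cancel_left_pos)
qed

section \<open>Reduction to the spectral gap\<close>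

lemma radial_integral_square_nonneg: "0 \<le> radial_integral p (\<lambda>x. f x * f x)"
  by (rule radial_integral_nonneg) simp

text \<open>With \<open>T = skew_euler p\<close> one has \<open>\<bar>x\<bar>\<^sup>2 \<Delta>u = T\<^sup>2 u - 2 g T u - (m\<^sup>2 - g\<^sup>2) u + \<Delta>\<^sub>S u\<close>;
  as \<open>T\<close> is skew-symmetric and commutes with \<open>\<Delta>\<^sub>S\<close>, most cross terms drop out.\<close>

lemma radial_integral_lap_square:
  fixes u :: "real^'n::finite \<Rightarrow> real" and m g :: real
  assumes u: "punctured_test u"
    and m: "m = (real CARD('n) - 2) / 2" and g: "g = (p + 2) / 2"
  shows "radial_integral (p + 4) (\<lambda>x. lap u x * lap u x) =
      radial_integral p (\<lambda>x. skew_euler p (skew_euler p u) x * skew_euler p (skew_euler p u) x)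
      + 2 * radial_integral p (spherical_inner (skew_euler p u) (skew_euler p u))
      + radial_integral p (\<lambda>x. spherical_lap u x * spherical_lap u x)
      + 2 * (m\<^sup>2 - g\<^sup>2) * (radial_integral p (\<lambda>x. skew_euler p u x * skew_euler p u x)
          + radial_integral p (spherical_inner u u))
      + 4 * g\<^sup>2 * radial_integral p (\<lambda>x. skew_euler p u x * skew_euler p u x)
      + (m\<^sup>2 - g\<^sup>2)\<^sup>2 * radial_integral p (\<lambda>x. u x * u x)"
proof -
  define T where "T = skew_euler p u"
  define TT where "TT = skew_euler p T"
  define C where "C = spherical_lap u"
  define b where "b = m\<^sup>2 - g\<^sup>2"
  let ?J = "radial_integral p"
  have s: "smooth u" using u by (rule punctured_test_smooth)
  have T: "punctured_test T" unfolding T_def using u by (rule punctured_test_skew_euler)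
  have TT: "punctured_test TT" unfolding TT_def using T by (rule punctured_test_skew_euler)
  have C: "punctured_test C" unfolding C_def using u by (rule punctured_test_spherical_lap)
  \<comment> \<open>A skew-symmetric operator has zero diagonal.\<close>
  have skew0: "?J (\<lambda>x. skew_euler p f x * f x) = 0" if "punctured_test f" for f :: "real^'n \<Rightarrow> real"
    using radial_integral_skew_euler[OF that that, of p] by (simp add: mult.commute)
  have Tu: "?J (\<lambda>x. T x * u x) = 0" unfolding T_def by (rule skew0[OF u])
  have TTT: "?J (\<lambda>x. TT x * T x) = 0" unfolding TT_def by (rule skew0[OF T])
  have TTu: "?J (\<lambda>x. TT x * u x) = - ?J (\<lambda>x. T x * T x)"
    unfolding TT_def radial_integral_skew_euler[OF T u] by (simp add: T_def)
  have Cu: "?J (\<lambda>x. C x * f x) = - ?J (spherical_inner u f)" if "punctured_test f" for f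
    unfolding C_def using s that by (rule spherical_lap_by_parts)
  have sc: "spherical_inner T u = spherical_inner u T"
    by (rule ext) (rule spherical_inner_commute)
  have CT: "?J (\<lambda>x. C x * T x) = 0"
    using radial_integral_spherical_inner_skew_euler[OF u u, of p]
    unfolding T_def[symmetric] Cu[OF T] sc by simp
  have CTT: "?J (\<lambda>x. C x * TT x) = ?J (spherical_inner T T)"
    using radial_integral_spherical_inner_skew_euler[OF u T, of p]
    by (simp add: Cu TT T_def[symmetric] TT_def[symmetric])
  have expand: "((norm x)\<^sup>2 * lap u x) * ((norm x)\<^sup>2 * lap u x) =
      TT x * TT x + 2 * (C x * TT x) + C x * C x + (4 * g\<^sup>2) * (T x * T x) + b\<^sup>2 * (u x * u x)
      + (- 4 * g) * (TT x * T x) + (- 2 * b) * (TT x * u x) + (4 * g * b) * (T x * u x)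
      + (- 4 * g) * (C x * T x) + (- 2 * b) * (C x * u x)" for x
  proof -
    have eT: "euler T x = euler (euler u) x + (p + real CARD('n)) / 2 * euler u x"
      unfolding T_def skew_euler_def[abs_def]
      using s by (simp add: euler_add euler_mult euler_const smooth_op_simps del: times_divide_eq_left)
    have "(norm x)\<^sup>2 * lap u x = C x + euler (euler u) x + (real CARD('n) - 2) * euler u x"
      by (simp add: C_def spherical_lap_def)
    \<comment> \<open>With E = T - (m + g) one gets E^2 + 2 m E = T^2 - 2 g T - (m^2 - g^2), since
      \<open>m + g\<close> is the shift \<open>(p + n) / 2\<close>.\<close>
    also have "\<dots> = TT x + C x - 2 * g * T x - b * u x"
      unfolding TT_def skew_euler_def[of p T] eT
      by (simp add: T_def skew_euler_def m g b_def power2_eq_square field_simps)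
    finally show ?thesis by (simp only:) (simp add: power2_eq_square algebra_simps)
  qed
  have "radial_integral (p + 4) (\<lambda>x. lap u x * lap u x) =
      ?J (\<lambda>x. (norm x)\<^sup>2 * ((norm x)\<^sup>2 * (lap u x * lap u x)))"
    by (simp only: radial_integral_norm_square) (simp add: add.commute)
  also have "\<dots> = ?J (\<lambda>x. ((norm x)\<^sup>2 * lap u x) * ((norm x)\<^sup>2 * lap u x))"
    by (simp add: mult_ac)
  also have "\<dots> = ?J (\<lambda>x. TT x * TT x) + 2 * ?J (\<lambda>x. C x * TT x) + ?J (\<lambda>x. C x * C x)
      + (4 * g\<^sup>2) * ?J (\<lambda>x. T x * T x) + b\<^sup>2 * ?J (\<lambda>x. u x * u x)
      + (- 4 * g) * ?J (\<lambda>x. TT x * T x) + (- 2 * b) * ?J (\<lambda>x. TT x * u x) + (4 * g * b) * ?J (\<lambda>x. T x * u x)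
      + (- 4 * g) * ?J (\<lambda>x. C x * T x) + (- 2 * b) * ?J (\<lambda>x. C x * u x)"
    unfolding expand using u T TT C
    by (simp only: radial_integral_add radial_integral_cmult punctured_test_add punctured_test_cmult
        punctured_test_mult_left punctured_test_smooth)
  finally show ?thesis
    unfolding Tu TTT TTu CT CTT Cu[OF u]
    by (simp add: T_def[symmetric] TT_def[symmetric] C_def[symmetric] b_def[symmetric] algebra_simps)
qed

text \<open>Radial and tangential parts of the gradient separate, and \<open>euler u\<close> is
  \<open>T - \<kappa> u\<close> with a cross term of integral 0. Dropping the first two forms would
  leave the weighted Hardy inequality with constant \<kappa>^2.\<close>

lemma radial_integral_gradient_square:
  fixes u :: "real^'n::finite \<Rightarrow> real"
  assumes u: "punctured_test u"
  shows "radial_integral (p + 2) (\<lambda>x. \<Sum>k\<in>UNIV. pd k u x * pd k u x) =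
      radial_integral p (\<lambda>x. skew_euler p u x * skew_euler p u x)
      + radial_integral p (spherical_inner u u)
      + ((p + real CARD('n)) / 2)\<^sup>2 * radial_integral p (\<lambda>x. u x * u x)"
proof -
  define \<kappa> where "\<kappa> = (p + real CARD('n)) / 2"
  define T where "T = skew_euler p u"
  let ?J = "radial_integral p"
  have s: "smooth u" using u by (rule punctured_test_smooth)
  have T: "punctured_test T" unfolding T_def using u by (rule punctured_test_skew_euler)
  have Tu: "?J (\<lambda>x. T x * u x) = 0"
    unfolding T_def using radial_integral_skew_euler[OF u u, of p] by (simp add: mult.commute)
  have "(norm x)\<^sup>2 * (\<Sum>k\<in>UNIV. pd k u x * pd k u x) =
      T x * T x + spherical_inner u u x + (- 2 * \<kappa>) * (T x * u x) + \<kappa>\<^sup>2 * (u x * u x)" for x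
    by (simp add: spherical_inner_def T_def skew_euler_def power2_eq_square algebra_simps flip: \<kappa>_def)
  then have "radial_integral (p + 2) (\<lambda>x. \<Sum>k\<in>UNIV. pd k u x * pd k u x) =
      ?J (\<lambda>x. T x * T x + spherical_inner u u x + (- 2 * \<kappa>) * (T x * u x) + \<kappa>\<^sup>2 * (u x * u x))"
    by (simp flip: radial_integral_norm_square)
  also have "\<dots> = ?J (\<lambda>x. T x * T x) + ?J (spherical_inner u u) + (- 2 * \<kappa>) * ?J (\<lambda>x. T x * u x)
      + \<kappa>\<^sup>2 * ?J (\<lambda>x. u x * u x)"
    using u T
    by (simp only: radial_integral_add radial_integral_cmult punctured_test_add punctured_test_cmult
        punctured_test_mult_left punctured_test_smooth punctured_test_spherical_inner)
  finally show ?thesis using Tu by (simp add: T_def \<kappa>_def)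
qed

text \<open>The hypotheses on \<open>s\<close> ensure that
  \<open>(\<xi>\<^sup>2 + \<lambda>) (\<xi>\<^sup>2 + \<lambda> + 2 (m\<^sup>2 - g\<^sup>2) + s) + 4 g\<^sup>2 \<xi>\<^sup>2\<close>, the symbol of the difference of the two
  sides in the logarithmic radial variable, is nonnegative for \<open>\<lambda> \<in> {0} \<union> [n - 1, \<infinity>)\<close>.\<close>

lemma rellich_inequality_real:
  fixes u :: "real^'n::finite \<Rightarrow> real"
  assumes u: "punctured_test u" and n: "n = real CARD('n)"
    and gap: "(n - 1) * radial_integral (\<gamma> - 4) (spherical_inner u u)
      \<le> radial_integral (\<gamma> - 4) (\<lambda>x. spherical_lap u x * spherical_lap u x)"
    and s: "((\<gamma> - 2)\<^sup>2 \<le> n - 1 \<and> s \<ge> - (1/2) * ((n - 2)\<^sup>2 + (\<gamma> - 2)\<^sup>2)) \<or>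
      ((\<gamma> - 2)\<^sup>2 \<ge> n - 1 \<and> s \<ge> - (1/2) * ((n - 2)\<^sup>2 - (\<gamma> - 2)\<^sup>2) + 1 - n)"
  shows "- s * radial_integral (\<gamma> - 2) (\<lambda>x. \<Sum>k\<in>UNIV. pd k u x * pd k u x)
      + ((\<gamma> + n - 4) / 4)\<^sup>2 * ((\<gamma> - n)\<^sup>2 + 4 * s) * radial_integral (\<gamma> - 4) (\<lambda>x. u x * u x)
    \<le> radial_integral \<gamma> (\<lambda>x. lap u x * lap u x)"
proof -
  define p where "p = \<gamma> - 4"
  define m where "m = (n - 2) / 2"
  define g where "g = (\<gamma> - 2) / 2"
  define T where "T = skew_euler p u"
  define A where "A = radial_integral p (\<lambda>x. skew_euler p T x * skew_euler p T x)"
  define X where "X = radial_integral p (spherical_inner T T)"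
  define Y where "Y = radial_integral p (spherical_inner u u)"
  define Z where "Z = radial_integral p (\<lambda>x. spherical_lap u x * spherical_lap u x)"
  define K where "K = radial_integral p (\<lambda>x. u x * u x)"
  define Q where "Q = radial_integral p (\<lambda>x. T x * T x)"
  have "A \<ge> 0" "Q \<ge> 0" "K \<ge> 0"
    unfolding A_def Q_def K_def by (rule radial_integral_square_nonneg)+
  have "X \<ge> 0" "Y \<ge> 0"
    unfolding X_def Y_def by (intro radial_integral_nonneg spherical_inner_nonneg)+
  have gap': "(n - 1) * Y \<le> Z" using gap by (simp add: Y_def Z_def p_def)
  have lap: "radial_integral \<gamma> (\<lambda>x. lap u x * lap u x) =
      A + 2 * X + Z + 2 * (m\<^sup>2 - g\<^sup>2) * (Q + Y) + 4 * g\<^sup>2 * Q + (m\<^sup>2 - g\<^sup>2)\<^sup>2 * K"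
    using radial_integral_lap_square[OF u, of m g p]
    by (simp add: A_def X_def Y_def Z_def K_def Q_def T_def m_def g_def p_def n)
  have grad: "radial_integral (\<gamma> - 2) (\<lambda>x. \<Sum>k\<in>UNIV. pd k u x * pd k u x) = Q + Y + (m + g)\<^sup>2 * K"
  proof -
    have "m + g = (p + real CARD('n)) / 2" by (simp add: m_def g_def p_def n field_simps)
    then show ?thesis
      using radial_integral_gradient_square[OF u, of p]
      by (simp only: Y_def K_def Q_def T_def) (simp add: p_def)
  qed
  \<comment> \<open>The two factors are ((m + g) / 2)^2 and 4 ((g - m)^2 + s). In this form all
    multiples of \<open>K\<close> cancel between the two sides.\<close>
  have coeff: "((\<gamma> + n - 4) / 4)\<^sup>2 * ((\<gamma> - n)\<^sup>2 + 4 * s) = (m\<^sup>2 - g\<^sup>2)\<^sup>2 + s * (m + g)\<^sup>2"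
    unfolding m_def g_def by (simp add: power2_eq_square field_simps)
  have mm: "m\<^sup>2 = (n - 2)\<^sup>2 / 4" and gg: "4 * g\<^sup>2 = (\<gamma> - 2)\<^sup>2"
    by (simp_all add: m_def g_def power_divide)
  \<comment> \<open>It suffices that 2 (m^2 - g^2) + s is at least -4 g^2, for the \<open>Q\<close>
    terms, and at least -(n - 1), for the \<open>Y\<close> terms after using the gap. The bound on
    \<open>s\<close> gives one of the two, the comparison of 4 g^2 with n - 1 the other.\<close>
  have key: "0 \<le> Z + (2 * (m\<^sup>2 - g\<^sup>2) + s) * (Q + Y) + 4 * g\<^sup>2 * Q"
    using s
  proof (elim disjE conjE)
    assume g: "(\<gamma> - 2)\<^sup>2 \<le> n - 1" and "- (1/2) * ((n - 2)\<^sup>2 + (\<gamma> - 2)\<^sup>2) \<le> s"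
    then have "- (4 * g\<^sup>2) \<le> 2 * (m\<^sup>2 - g\<^sup>2) + s"
      using mm gg by (simp add: field_simps)
    then have "- (4 * g\<^sup>2) * (Q + Y) \<le> (2 * (m\<^sup>2 - g\<^sup>2) + s) * (Q + Y)"
      using \<open>Q \<ge> 0\<close> \<open>Y \<ge> 0\<close> by (intro mult_right_mono) auto
    moreover have "(4 * g\<^sup>2) * Y \<le> (n - 1) * Y"
      using g \<open>Y \<ge> 0\<close> by (intro mult_right_mono) (auto simp: gg)
    ultimately show ?thesis using gap' by (simp add: algebra_simps)
  next
    assume g: "(\<gamma> - 2)\<^sup>2 \<ge> n - 1" and "- (1/2) * ((n - 2)\<^sup>2 - (\<gamma> - 2)\<^sup>2) + 1 - n \<le> s"
    then have "- (n - 1) \<le> 2 * (m\<^sup>2 - g\<^sup>2) + s"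
      using mm gg by (simp add: field_simps)
    then have "- (n - 1) * (Q + Y) \<le> (2 * (m\<^sup>2 - g\<^sup>2) + s) * (Q + Y)"
      using \<open>Q \<ge> 0\<close> \<open>Y \<ge> 0\<close> by (intro mult_right_mono) auto
    moreover have "(n - 1) * Q \<le> (4 * g\<^sup>2) * Q"
      using g \<open>Q \<ge> 0\<close> by (intro mult_right_mono) (auto simp: gg)
    ultimately show ?thesis using gap' by (simp add: algebra_simps)
  qed
  show ?thesis
    unfolding lap grad coeff p_def[symmetric] K_def[symmetric]
    using key \<open>A \<ge> 0\<close> \<open>X \<ge> 0\<close> by (simp add: algebra_simps)
qed

section \<open>Wirtinger's inequality\<close>

text \<open>The function \<open>k tan (k (x - a - \<pi> / 2))\<close> with \<open>k < 1\<close> is a solution of the Riccati equation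
  \<open>T' = k\<^sup>2 + T\<^sup>2\<close> which stays finite on all of \<open>[a, a + \<pi>]\<close>.\<close>

lemma wirtinger_inequality_Dirichlet:
  fixes v v' :: "real \<Rightarrow> real"
  assumes v: "\<And>x. (v has_real_derivative v' x) (at x)" and cont: "continuous_on UNIV v'"
    and zero: "v a = 0" "v (a + pi) = 0"
  shows "integral {a..a + pi} (\<lambda>x. (v x)\<^sup>2) \<le> integral {a..a + pi} (\<lambda>x. (v' x)\<^sup>2)"
proof (rule field_le_mult_one_interval)
  fix z :: real
  assume z: "0 < z" "z < 1"
  \<comment> \<open>At \<open>k = 1\<close> the tangent would have poles at both end points. So the
    claim is shown with a factor \<open>z = k\<^sup>2 < 1\<close>, and \<open>z\<close> is
    arbitrarily close to 1.\<close>
  define k where "k = sqrt z"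
  have k: "0 < k" "k < 1" "k\<^sup>2 = z" using z by (simp_all add: k_def)
  define T where "T x = k * tan (k * (x - a - pi / 2))" for x
  have cos: "cos (k * (x - a - pi / 2)) > 0" if "x \<in> {a..a + pi}" for x
  proof (rule cos_gt_zero_pi)
    have "\<bar>k * (x - a - pi / 2)\<bar> = k * \<bar>x - a - pi / 2\<bar>" using k by (simp add: abs_mult)
    also have "\<bar>x - a - pi / 2\<bar> \<le> pi / 2" unfolding abs_le_iff using that by auto
    then have "k * \<bar>x - a - pi / 2\<bar> \<le> k * (pi / 2)" using k by (intro mult_left_mono) auto
    also have "\<dots> < 1 * (pi / 2)" using k by (intro mult_strict_right_mono) auto
    finally show "- (pi / 2) < k * (x - a - pi / 2)" "k * (x - a - pi / 2) < pi / 2" by auto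
  qed
  have T: "(T has_real_derivative k\<^sup>2 + (T x)\<^sup>2) (at x)" if "x \<in> {a..a + pi}" for x
  proof -
    have nz: "cos (k * (x - a - pi / 2)) \<noteq> 0" using cos[OF that] by simp
    have "(T has_real_derivative k * (inverse ((cos (k * (x - a - pi / 2)))\<^sup>2) * k)) (at x)"
      unfolding T_def using nz by (auto intro!: derivative_eq_intros)
    also have "k * (inverse ((cos (k * (x - a - pi / 2)))\<^sup>2) * k) = k\<^sup>2 + (T x)\<^sup>2"
      using tan_sec[OF nz] unfolding T_def power_inverse[symmetric]
      by (simp only: power_mult_distrib flip: tan_sec[OF nz]) (simp add: power2_eq_square algebra_simps)
    finally show ?thesis .
  qed
  have contv: "continuous_on S v" for S
    using v by (meson DERIV_isCont continuous_at_imp_continuous_on)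
  have contv': "continuous_on S v'" for S
    using cont continuous_on_subset by blast
  \<comment> \<open>The derivative of \<open>T v\<^sup>2\<close>, of integral 0 by the boundary
    values. Adding it to \<open>(v')\<^sup>2\<close> gives
    \<open>k\<^sup>2 v\<^sup>2 + (v' + T v)\<^sup>2\<close>.\<close>
  define \<phi>' where "\<phi>' x = (k\<^sup>2 + (T x)\<^sup>2) * (v x)\<^sup>2 + T x * (2 * v x * v' x)" for x
  have "((\<lambda>x. T x * (v x)\<^sup>2) has_real_derivative \<phi>' x) (at x)" if "x \<in> {a..a + pi}" for x
    unfolding \<phi>'_def using T[OF that] v[of x] by (auto intro!: derivative_eq_intros)
  then have "(\<phi>' has_integral T (a + pi) * (v (a + pi))\<^sup>2 - T a * (v a)\<^sup>2) {a..a + pi}"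
    by (intro fundamental_theorem_of_calculus)
      (auto intro: has_field_derivative_at_within simp flip: has_real_derivative_iff_has_vector_derivative)
  then have int: "(\<phi>' has_integral 0) {a..a + pi}" using zero by simp
  have iv: "(\<lambda>x. (v x)\<^sup>2) integrable_on {a..a + pi}" "(\<lambda>x. (v' x)\<^sup>2) integrable_on {a..a + pi}"
    by (intro integrable_continuous_real continuous_intros contv contv')+
  have "z * integral {a..a + pi} (\<lambda>x. (v x)\<^sup>2) = integral {a..a + pi} (\<lambda>x. z * (v x)\<^sup>2)"
    by simp
  also have "\<dots> \<le> integral {a..a + pi} (\<lambda>x. (v' x)\<^sup>2 + \<phi>' x)"
  proof (rule integral_le)
    show "(\<lambda>x. z * (v x)\<^sup>2) integrable_on {a..a + pi}"
      "(\<lambda>x. (v' x)\<^sup>2 + \<phi>' x) integrable_on {a..a + pi}"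
      using iv int by (auto intro: integrable_on_mult_right integrable_add has_integral_integrable)
    fix x
    have "0 \<le> (v' x + T x * v x)\<^sup>2" by simp
    then show "z * (v x)\<^sup>2 \<le> (v' x)\<^sup>2 + \<phi>' x"
      by (simp add: \<phi>'_def k(3)[symmetric] power2_eq_square algebra_simps)
  qed
  also have "\<dots> = integral {a..a + pi} (\<lambda>x. (v' x)\<^sup>2)"
    using iv int by (subst Henstock_Kurzweil_Integration.integral_add)
      (auto simp: has_integral_integrable integral_unique)
  finally show "z * integral {a..a + pi} (\<lambda>x. (v x)\<^sup>2) \<le> integral {a..a + pi} (\<lambda>x. (v' x)\<^sup>2)" .
qed

text \<open>The piece beyond \<open>c\<close> is moved back by one period and fills the gap
  \<open>{0..a}\<close>.\<close>

lemma integral_periodic_shift: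
  fixes h :: "real \<Rightarrow> real"
  assumes cont: "continuous_on UNIV h" and per: "\<And>x. h (x + c) = h x" and a: "0 \<le> a" "a \<le> c"
  shows "integral {a..a + c} h = integral {0..c} h"
proof -
  have int: "h integrable_on {l..r}" for l r
    using cont by (intro integrable_continuous_real) (auto intro: continuous_on_subset)
  have "integral {0..a} (h \<circ> (+) c) = integral {0 + c..a + c} h"
    by (rule integral_shift_Icc_real)
  moreover have "h \<circ> (+) c = h" using per by (auto simp: add.commute)
  ultimately have "integral {0..a} h = integral {c..a + c} h" by simp
  then show ?thesis
    using Henstock_Kurzweil_Integration.integral_combine[OF a int]
      Henstock_Kurzweil_Integration.integral_combine[of a c "a + c", OF _ _ int] a by simp
qed

text \<open>Hurwitz's argument: a point \<open>\<tau>\<close> where \<open>U'\<close> takes the same value at \<open>\<tau>\<close> and \<open>\<tau> + \<pi>\<close> cuts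
  the circle into two arcs on which the Dirichlet inequality applies.\<close>

lemma wirtinger_inequality_periodic:
  fixes U U' U'' :: "real \<Rightarrow> real"
  assumes per: "\<And>x. U (x + 2 * pi) = U x"
    and U: "\<And>x. (U has_real_derivative U' x) (at x)"
    and U': "\<And>x. (U' has_real_derivative U'' x) (at x)" and cont: "continuous_on UNIV U''"
  shows "integral {0..2 * pi} (\<lambda>x. (U' x)\<^sup>2) \<le> integral {0..2 * pi} (\<lambda>x. (U'' x)\<^sup>2)"
proof -
  have shift: "(g has_real_derivative d) (at (x + 2 * pi)) \<Longrightarrow> (\<And>x. g (x + 2 * pi) = g x) \<Longrightarrow>
    (g has_real_derivative d) (at x)" for g d x
    using DERIV_shift[of g d x "2 * pi"] by simp
  have per': "U' (x + 2 * pi) = U' x" for x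
    using shift[OF U per] U by (blast intro: DERIV_unique)
  have per'': "U'' (x + 2 * pi) = U'' x" for x
    using shift[OF U' per'] U' by (blast intro: DERIV_unique)
  have cU': "continuous_on S U'" for S
    using U' by (meson DERIV_isCont continuous_at_imp_continuous_on)
  have cU'': "continuous_on S U''" for S
    using cont continuous_on_subset by blast
  define d where "d x = U' (x + pi) - U' x" for x
  \<comment> \<open>The sign change of \<open>d\<close> over half a period yields the point \<tau>
    by the intermediate value theorem.\<close>
  have "d pi = - d 0" using per'[of 0] by (simp add: d_def)
  moreover have "continuous_on {0..pi} d"
    unfolding d_def by (intro continuous_intros continuous_on_compose2[OF cU'[of UNIV]] cU') auto
  ultimately obtain \<tau> where \<tau>: "0 \<le> \<tau>" "\<tau> \<le> pi" "d \<tau> = 0"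
    using IVT'[of d 0 0 pi] IVT2'[of d pi 0 0] by (cases "d 0 \<le> 0") auto
  define c where "c = U' \<tau>"
  define v where "v x = U' x - c" for x
  have v: "(v has_real_derivative U'' x) (at x)" for x
    unfolding v_def using U'[of x] by (auto intro!: derivative_eq_intros)
  have v0: "v \<tau> = 0" "v (\<tau> + pi) = 0" "v (\<tau> + pi + pi) = 0"
    using \<tau>(3) per'[of \<tau>] by (simp_all add: v_def c_def d_def add.assoc)
  have cv: "continuous_on S v" for S
    unfolding v_def by (intro continuous_intros cU')
  have int: "(\<lambda>x. (v x)\<^sup>2) integrable_on {l..r}" "(\<lambda>x. (U'' x)\<^sup>2) integrable_on {l..r}"
    "(\<lambda>x. (U' x)\<^sup>2) integrable_on {l..r}" "U' integrable_on {l..r}" for l r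
    by (intro integrable_continuous_real continuous_intros cv cU' cU'')+
  let ?I = "{\<tau>..\<tau> + 2 * pi}"
  have split: "integral ?I f = integral {\<tau>..\<tau> + pi} f + integral {\<tau> + pi..\<tau> + pi + pi} f"
    if "\<And>l r. f integrable_on {l..r}" for f :: "real \<Rightarrow> real"
    using Henstock_Kurzweil_Integration.integral_combine[of \<tau> "\<tau> + pi" "\<tau> + 2 * pi" f] that
    by (simp add: add.assoc)
  have le: "integral ?I (\<lambda>x. (v x)\<^sup>2) \<le> integral ?I (\<lambda>x. (U'' x)\<^sup>2)"
    unfolding split[OF int(1)] split[OF int(2)]
    by (intro add_mono wirtinger_inequality_Dirichlet v cont v0)
  have "(U' has_integral U (\<tau> + 2 * pi) - U \<tau>) ?I"
    using U by (intro fundamental_theorem_of_calculus)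
      (auto intro: has_field_derivative_at_within simp flip: has_real_derivative_iff_has_vector_derivative)
  then have mean: "integral ?I U' = 0" using per by (simp add: integral_unique)
  \<comment> \<open>Since \<open>U'\<close> has mean zero, subtracting the constant \<open>c\<close>
    can only increase the integral of the square.\<close>
  have "integral ?I (\<lambda>x. (U' x)\<^sup>2) = integral ?I (\<lambda>x. (U' x)\<^sup>2) - 2 * c * integral ?I U'"
    using mean by simp
  also have "\<dots> = integral ?I (\<lambda>x. (U' x)\<^sup>2 - 2 * c * U' x)"
    by (subst Henstock_Kurzweil_Integration.integral_diff)
      (auto intro!: integrable_continuous_real continuous_intros cU')
  also have "\<dots> \<le> integral ?I (\<lambda>x. (v x)\<^sup>2)"
    by (intro integral_le integrable_continuous_real continuous_intros cv cU')
      (simp add: v_def power2_eq_square algebra_simps)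
  also note le
  finally have "integral ?I (\<lambda>x. (U' x)\<^sup>2) \<le> integral ?I (\<lambda>x. (U'' x)\<^sup>2)" .
  moreover have "integral ?I (\<lambda>x. (U' x)\<^sup>2) = integral {0..2 * pi} (\<lambda>x. (U' x)\<^sup>2)"
    "integral ?I (\<lambda>x. (U'' x)\<^sup>2) = integral {0..2 * pi} (\<lambda>x. (U'' x)\<^sup>2)"
    using \<tau> by (intro integral_periodic_shift continuous_intros cU' cU''; simp add: per' per'')+
  ultimately show ?thesis by simp
qed

section \<open>Rotations of the plane\<close>

lemma frechet_derivative_eq_sum_pd:
  assumes "smooth f"
  shows "frechet_derivative f (at x) v = (\<Sum>k\<in>UNIV. v $ k * pd k f x)"
proof -
  have lin: "linear (frechet_derivative f (at x))"
    using assms by (simp add: linear_frechet_derivative smooth_differentiable)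
  have "frechet_derivative f (at x) v = frechet_derivative f (at x) (\<Sum>k\<in>UNIV. v $ k *\<^sub>R axis k 1)"
    using basis_expansion[of v] by (simp add: scalar_mult_eq_scaleR)
  also have "\<dots> = (\<Sum>k\<in>UNIV. v $ k * pd k f x)"
    by (simp add: linear_sum[OF lin] linear_cmul[OF lin] pd_def)
  finally show ?thesis .
qed

lemma continuously_differentiable_compose_linear:
  fixes A :: "'a::euclidean_space \<Rightarrow> 'b::euclidean_space" and f :: "'b \<Rightarrow> 'c::real_normed_vector"
  assumes A: "bounded_linear A"
  shows "continuously_differentiable k f \<Longrightarrow> continuously_differentiable k (\<lambda>x. f (A x))"
proof (induction k arbitrary: f)
  case 0
  then show ?case
    using continuous_on_compose2[of UNIV f UNIV A] linear_continuous_on[OF A] by simp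
next
  case (Suc k)
  have D: "((\<lambda>x. f (A x)) has_derivative (\<lambda>v. frechet_derivative f (at (A x)) (A v))) (at x)" for x
  proof (rule has_derivative_compose[of A A _ _ f])
    show "(A has_derivative A) (at x)"
      by (rule bounded_linear.has_derivative[OF A has_derivative_ident])
    show "(f has_derivative frechet_derivative f (at (A x))) (at (A x))"
      using Suc.prems frechet_derivative_works by auto
  qed
  show ?case using Suc
    by (auto simp: frechet_derivative_at[OF D, symmetric] differentiable_def intro: D)
qed

lemma smooth_compose_linear: "bounded_linear A \<Longrightarrow> smooth f \<Longrightarrow> smooth (\<lambda>x. f (A x))"
  by (simp add: smooth_def continuously_differentiable_compose_linear)

text \<open>The index type is known only to have two elements; fixing \<open>i\<close> and
  \<open>j\<close> names the coordinates and orients the plane.\<close>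

locale plane =
  fixes i j :: "'n::finite"
  assumes i_neq_j: "i \<noteq> j" and UNIV_eq: "UNIV = {i, j}"
begin

lemma sum_UNIV: "(\<Sum>k\<in>UNIV. f k) = f i + f j" for f :: "'n \<Rightarrow> 'a::comm_monoid_add"
  unfolding UNIV_eq using i_neq_j by simp

definition rotate_by :: "real \<Rightarrow> real^'n \<Rightarrow> real^'n"
  where "rotate_by t x = (\<chi> k. if k = i then cos t * x $ i - sin t * x $ j else sin t * x $ i + cos t * x $ j)"

text \<open>The generator of the rotations, \<partial>/\<partial>\<theta> in polar
  coordinates.\<close>

definition angular :: "(real^'n \<Rightarrow> real) \<Rightarrow> real^'n \<Rightarrow> real"
  where "angular f x = x $ i * pd j f x - x $ j * pd i f x"

lemma rotate_by_component:
  "rotate_by t x $ i = cos t * x $ i - sin t * x $ j" "rotate_by t x $ j = sin t * x $ i + cos t * x $ j"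
  using i_neq_j by (simp_all add: rotate_by_def)

lemma vec_eq: "x = y \<longleftrightarrow> x $ i = y $ i \<and> x $ j = y $ j" for x y :: "real^'n"
  unfolding vec_eq_iff using UNIV_eq by (metis UNIV_I insertE singletonD)

lemma rotate_by_0: "rotate_by 0 x = x"
  by (simp add: vec_eq rotate_by_component)

lemma rotate_by_2pi: "rotate_by (t + 2 * pi) x = rotate_by t x"
  by (simp add: vec_eq rotate_by_component)

lemma norm_rotate_by: "norm (rotate_by t x) = norm x"
proof -
  have "(norm (rotate_by t x))\<^sup>2 = ((cos t)\<^sup>2 + (sin t)\<^sup>2) * (norm x)\<^sup>2"
    unfolding sum_square_component[symmetric] sum_UNIV rotate_by_component by algebra
  then show ?thesis by (simp add: norm_eq_sqrt_inner power2_norm_eq_inner)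
qed

lemma bounded_linear_rotate_by: "bounded_linear (rotate_by t)"
  by (rule linear_conv_bounded_linear[THEN iffD1], rule linearI)
    (simp_all add: vec_eq rotate_by_component algebra_simps)

lemma continuous_on_rotate_by: "continuous_on S (\<lambda>z. rotate_by (fst z) (snd z))"
  unfolding rotate_by_def
proof (rule continuous_on_vec_lambda)
  fix k
  show "continuous_on S (\<lambda>z. if k = i then cos (fst z) * snd z $ i - sin (fst z) * snd z $ j
      else sin (fst z) * snd z $ i + cos (fst z) * snd z $ j)"
    by (cases "k = i") (auto intro!: continuous_intros)
qed

lemma rotate_by_has_derivative:
  "((\<lambda>t. rotate_by t x) has_vector_derivative
    (\<chi> k. if k = i then - (rotate_by t x $ j) else rotate_by t x $ i)) (at t)"
proof -
  have "((\<lambda>t. \<Sum>k\<in>UNIV. rotate_by t x $ k *\<^sub>R axis k (1::real)) has_vector_derivative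
      (\<Sum>k\<in>UNIV. (if k = i then - (rotate_by t x $ j) else rotate_by t x $ i) *\<^sub>R axis k 1)) (at t)"
  proof (rule has_vector_derivative_sum)
    fix k
    have "k = i \<or> k = j" using UNIV_eq by blast
    then have "((\<lambda>t. rotate_by t x $ k) has_real_derivative
        (if k = i then - (rotate_by t x $ j) else rotate_by t x $ i)) (at t)"
      using i_neq_j by (auto simp: rotate_by_component intro!: derivative_eq_intros)
    from has_vector_derivative_scaleR[OF this has_vector_derivative_const, of "axis k 1"]
    show "((\<lambda>t. rotate_by t x $ k *\<^sub>R axis k (1::real)) has_vector_derivative
        (if k = i then - (rotate_by t x $ j) else rotate_by t x $ i) *\<^sub>R axis k 1) (at t)"
      by (simp only: scaleR_zero_right add_0_left add_0_right)
  qed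
  also have "(\<lambda>t. \<Sum>k\<in>UNIV. rotate_by t x $ k *\<^sub>R axis k (1::real)) = (\<lambda>t. rotate_by t x)"
    by (intro ext) (simp add: sum_UNIV vec_eq axis_def i_neq_j i_neq_j[symmetric])
  also have "(\<Sum>k\<in>UNIV. (if k = i then - (rotate_by t x $ j) else rotate_by t x $ i) *\<^sub>R axis k 1) =
      (\<chi> k. if k = i then - (rotate_by t x $ j) else rotate_by t x $ i)"
    by (simp add: sum_UNIV vec_eq axis_def i_neq_j i_neq_j[symmetric])
  finally show ?thesis .
qed

lemma rotation_orbit_derivative:
  assumes "smooth f"
  shows "((\<lambda>t. f (rotate_by t x)) has_real_derivative angular f (rotate_by t x)) (at t)"
proof -
  let ?y = "rotate_by t x"
  let ?w = "\<chi> k. if k = i then - (?y $ j) else ?y $ i"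
  have "((\<lambda>t. f (rotate_by t x)) has_derivative (\<lambda>s. frechet_derivative f (at ?y) (s *\<^sub>R ?w))) (at t)"
    using rotate_by_has_derivative[of x t] smooth_has_derivative[OF assms]
    unfolding has_vector_derivative_def by (rule has_derivative_compose)
  also have "(\<lambda>s. frechet_derivative f (at ?y) (s *\<^sub>R ?w)) = (*) (angular f ?y)"
    unfolding frechet_derivative_eq_sum_pd[OF assms] sum_UNIV angular_def
    using i_neq_j by (auto simp: algebra_simps)
  finally show ?thesis by (simp add: has_field_derivative_def)
qed

text \<open>Plane rotations commute with each other, hence with their generator.\<close>

lemma angular_rotate_by:
  assumes "smooth f"
  shows "angular (\<lambda>x. f (rotate_by t x)) x = angular f (rotate_by t x)"
proof -
  let ?A = "rotate_by t"
  have "((\<lambda>x. f (?A x)) has_derivative (\<lambda>v. frechet_derivative f (at (?A x)) (?A v))) (at x)"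
    by (rule has_derivative_compose[of ?A ?A _ _ f])
      (rule bounded_linear.has_derivative[OF bounded_linear_rotate_by has_derivative_ident]
        smooth_has_derivative[OF assms])+
  then have pd: "pd k (\<lambda>x. f (?A x)) x = frechet_derivative f (at (?A x)) (?A (axis k 1))" for k
    by (rule pd_eqI)
  show ?thesis
    unfolding angular_def pd frechet_derivative_eq_sum_pd[OF assms] sum_UNIV
    by (simp add: rotate_by_component axis_def i_neq_j i_neq_j[symmetric] algebra_simps)
qed

lemma punctured_test_angular: "punctured_test f \<Longrightarrow> punctured_test (angular f)"
  unfolding angular_def[abs_def] by (simp add: punctured_test_simps smooth_simps)

lemma punctured_test_rotate_by:
  fixes f :: "real^'n \<Rightarrow> real"
  assumes "punctured_test f"
  shows "punctured_test (\<lambda>x. f (rotate_by t x))"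
  using assms smooth_compose_linear[OF bounded_linear_rotate_by, of f t]
  unfolding punctured_test_def by (metis norm_rotate_by)

text \<open>The rotation field is divergence free and orthogonal to \<open>x\<close>.\<close>

lemma radial_integral_angular:
  fixes f :: "real^'n \<Rightarrow> real"
  assumes f: "punctured_test f"
  shows "radial_integral p (angular f) = 0"
proof -
  define F where "F k x = (if k = i then - (x $ j) else x $ i) * f x" for k and x :: "real^'n"
  have "punctured_test (F k)" for k
    unfolding F_def[abs_def] using f by (cases "k = i") (simp_all add: punctured_test_simps smooth_simps)
  moreover have "(\<Sum>k\<in>UNIV. x $ k * F k x) = 0" for x
    using i_neq_j by (simp add: sum_UNIV F_def)
  moreover have "(\<Sum>k\<in>UNIV. pd k (F k) x) = angular f x" for x
    using i_neq_j f unfolding F_def[abs_def]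
    by (simp add: sum_UNIV pd_simps smooth_simps punctured_test_smooth angular_def)
  ultimately show ?thesis
    using radial_integral_divergence[of F p] by (simp add: radial_integral_def)
qed

section \<open>Averaging over the rotations\<close>

lemma continuous_on_powr_mult_rotate_by:
  fixes f :: "real^'n \<Rightarrow> real"
  assumes "punctured_test f"
  shows "continuous_on S (\<lambda>(t, x). norm x powr p * f (rotate_by t x))"
proof -
  have "continuous_on S (\<lambda>z. (\<lambda>x. norm x powr p * f x) (rotate_by (fst z) (snd z)))"
    by (rule continuous_on_compose2[OF continuous_on_powr_mult_punctured_test[OF assms] continuous_on_rotate_by]) simp
  then show ?thesis by (simp add: norm_rotate_by case_prod_beta)
qed

text \<open>Bridge to integrals over a box, where differentiation under the integral and interchange
  of integrals are carried out. One box serves all angles, because rotations preserve the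
  norm.\<close>

lemma integral_cbox_powr_mult_rotate_by:
  fixes f :: "real^'n \<Rightarrow> real"
  assumes f: "punctured_test f" and b: "\<And>x. b < norm x \<Longrightarrow> f x = 0"
  shows "integral (cbox (- (\<chi> k. b)) (\<chi> k. b)) (\<lambda>x. norm x powr p * f (rotate_by t x)) =
    radial_integral p (\<lambda>x. f (rotate_by t x))"
proof -
  let ?B = "cbox (- (\<chi> k. b)) (\<chi> k. b) :: (real^'n) set"
  let ?g = "\<lambda>x. norm x powr p * f (rotate_by t x)"
  have box: "x \<in> ?B" if "norm x \<le> b" for x
  proof -
    have "\<bar>x $ k\<bar> \<le> b" for k using component_le_norm_cart[of x k] that by linarith
    then show ?thesis by (auto simp: mem_box_cart abs_le_iff minus_le_iff)
  qed
  have "integral ?B ?g = integral UNIV ?g"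
  proof (rule integral_spike_set)
    have "{x \<in> ?B - UNIV. ?g x \<noteq> 0} = {}" by simp
    then show "negligible {x \<in> ?B - UNIV. ?g x \<noteq> 0}" by (metis negligible_empty)
    have "{x \<in> UNIV - ?B. ?g x \<noteq> 0} = {}"
      using box b by (force simp: norm_rotate_by)
    then show "negligible {x \<in> UNIV - ?B. ?g x \<noteq> 0}" by (metis negligible_empty)
  qed
  also have "\<dots> = radial_integral p (\<lambda>x. f (rotate_by t x))"
    unfolding radial_integral_def
    by (intro integral_lborel integrable_powr_mult_punctured_test punctured_test_rotate_by f)
  finally show ?thesis .
qed

text \<open>Change of variables for general linear maps is available only for well-ordered index types;
  differentiating in the angle avoids it.\<close>

lemma radial_integral_rotate_by:
  fixes f :: "real^'n \<Rightarrow> real"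
  assumes f: "punctured_test f"
  shows "radial_integral p (\<lambda>x. f (rotate_by t x)) = radial_integral p f"
proof -
  obtain b where b: "\<And>x. b < norm x \<Longrightarrow> f x = 0"
    using punctured_testE[OF f] by metis
  let ?B = "cbox (- (\<chi> k. b)) (\<chi> k. b) :: (real^'n) set"
  let ?g = "\<lambda>h t x. norm x powr p * h (rotate_by t x)"
  have "open {x::real^'n. b < norm x}"
    by (auto intro!: open_Collect_less continuous_intros)
  then have "pd k f x = 0" if "b < norm x" for k x
    using that b by (intro pd_eq_0_if_locally_0[of "{x. b < norm x}"]) auto
  then have supp': "angular f x = 0" if "b < norm x" for x
    using that by (simp add: angular_def)
  have "((\<lambda>t. integral ?B (?g f t)) has_real_derivative integral ?B (?g (angular f) t)) (at t)" for t
  proof (rule leibniz_rule_field_derivative)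
    show "((\<lambda>t. ?g f t x) has_real_derivative ?g (angular f) t x) (at t)" for t x
      using DERIV_cmult[OF rotation_orbit_derivative[OF punctured_test_smooth[OF f]]] .
    show "?g f t integrable_on ?B" for t
      using continuous_on_powr_mult_punctured_test[OF punctured_test_rotate_by[OF f]]
      by (intro integrable_continuous) (auto intro: continuous_on_subset)
    show "continuous_on (UNIV \<times> ?B) (\<lambda>(t, x). ?g (angular f) t x)"
      by (rule continuous_on_powr_mult_rotate_by[OF punctured_test_angular[OF f]])
  qed auto
  moreover have "integral ?B (?g (angular f) t) = 0" for t
  proof -
    \<comment> \<open>The angle derivative is thus itself an angular derivative of a test function,
      and so has integral 0.\<close>
    have "angular (\<lambda>x. f (rotate_by t x)) = (\<lambda>x. angular f (rotate_by t x))"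
      using f by (intro ext angular_rotate_by punctured_test_smooth)
    then show ?thesis
      using radial_integral_angular[OF punctured_test_rotate_by[OF f], of p t]
      by (simp add: integral_cbox_powr_mult_rotate_by[OF punctured_test_angular[OF f] supp'])
  qed
  ultimately have "integral ?B (?g f t) = integral ?B (?g f 0)"
    by (intro DERIV_isconst_all) simp
  then show ?thesis
    using integral_cbox_powr_mult_rotate_by[OF f b, where p = p and t = 0]
    by (simp add: integral_cbox_powr_mult_rotate_by[OF f b] rotate_by_0)
qed

text \<open>Integrate over \<open>x\<close> and over the angle in both orders: by rotation
  invariance one order gives \<open>2 * pi\<close> times the radial integral, the other integrates
  the nonnegative orbit means.\<close>

lemma radial_integral_nonneg_if_orbit_nonneg:
  fixes f :: "real^'n \<Rightarrow> real"
  assumes f: "punctured_test f" and orbit: "\<And>x. 0 \<le> integral {0..2 * pi} (\<lambda>t. f (rotate_by t x))"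
  shows "0 \<le> radial_integral p f"
proof -
  obtain b where b: "\<And>x. b < norm x \<Longrightarrow> f x = 0"
    using punctured_testE[OF f] by metis
  let ?B = "cbox (- (\<chi> k. b)) (\<chi> k. b) :: (real^'n) set"
  let ?g = "\<lambda>t x. norm x powr p * f (rotate_by t x)"
  have "0 \<le> integral ?B (\<lambda>x. norm x powr p * integral {0..2 * pi} (\<lambda>t. f (rotate_by t x)))"
    (is "0 \<le> integral ?B ?h")
    \<comment> \<open>A function that is not integrable has integral 0 by convention, so the sign
      holds in either case.\<close>
    using orbit by (cases "?h integrable_on ?B") (auto intro: integral_nonneg simp: not_integrable_integral)
  also have "\<dots> = integral ?B (\<lambda>x. integral (cbox 0 (2 * pi)) (\<lambda>t. ?g t x))"
    by simp
  also have "\<dots> = integral (cbox 0 (2 * pi)) (\<lambda>t. integral ?B (?g t))"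
    by (rule integral_swap_continuous[symmetric]) (rule continuous_on_powr_mult_rotate_by[OF f])
  also have "\<dots> = 2 * pi * radial_integral p f"
    by (simp add: integral_cbox_powr_mult_rotate_by[OF f b] radial_integral_rotate_by[OF f])
  finally show ?thesis using pi_gt_zero by (auto simp: zero_le_mult_iff)
qed

text \<open>Lagrange's identity for \<open>x\<close> and the two gradients in dimension two.\<close>

lemma spherical_inner_eq_angular: "spherical_inner f g x = angular f x * angular g x"
  unfolding spherical_inner_def euler_def angular_def sum_square_component[symmetric] sum_UNIV
  by (simp add: algebra_simps)

text \<open>For n = 2 the first-order term of \<open>spherical_lap\<close> drops out, leaving r^2
  \<Delta> - (r \<partial>/\<partial>r)^2, which is the second angular derivative.\<close>

lemma spherical_lap_eq_angular:
  fixes f :: "real^'n \<Rightarrow> real"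
  assumes "smooth f"
  shows "spherical_lap f x = angular (angular f) x"
proof -
  have "CARD('n) = 2" unfolding UNIV_eq using i_neq_j by simp
  moreover have "euler (euler f) x = euler f x + (\<Sum>k\<in>UNIV. x $ k * euler (pd k f) x)"
    by (simp add: euler_euler_eq_sum pd_euler assms distrib_left sum.distrib euler_def[of f])
  ultimately show ?thesis
    using i_neq_j assms
    unfolding spherical_lap_def lap_def euler_def angular_def[abs_def] sum_square_component[symmetric] sum_UNIV
    by (simp add: pd_simps smooth_simps pd_commute[OF assms, of i j] algebra_simps)
qed

text \<open>Wirtinger's inequality for \<open>f\<close> along each orbit of the rotations, averaged
  over the plane; the factor n - 1 is 1 here.\<close>

lemma spherical_gap_plane:
  fixes f :: "real^'n \<Rightarrow> real"
  assumes f: "punctured_test f"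
  shows "radial_integral p (spherical_inner f f) \<le> radial_integral p (\<lambda>x. spherical_lap f x * spherical_lap f x)"
proof -
  let ?L = "angular f" and ?LL = "angular (angular f)"
  have s: "smooth f" using f by (rule punctured_test_smooth)
  have L: "punctured_test ?L" "punctured_test ?LL"
    using f by (simp_all add: punctured_test_angular)
  have cont: "continuous_on S (\<lambda>t. h (rotate_by t x))" if "punctured_test h" for h S x
    using rotation_orbit_derivative[OF punctured_test_smooth[OF that]]
    by (meson DERIV_isCont continuous_at_imp_continuous_on)
  have "0 \<le> radial_integral p (\<lambda>x. ?LL x * ?LL x - ?L x * ?L x)"
  proof (rule radial_integral_nonneg_if_orbit_nonneg)
    show "punctured_test (\<lambda>x. ?LL x * ?LL x - ?L x * ?L x)"
      using L by (simp add: punctured_test_simps punctured_test_smooth)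
    fix x
    have "integral {0..2 * pi} (\<lambda>t. (?L (rotate_by t x))\<^sup>2) \<le> integral {0..2 * pi} (\<lambda>t. (?LL (rotate_by t x))\<^sup>2)"
      by (rule wirtinger_inequality_periodic[of "\<lambda>t. f (rotate_by t x)"])
        (auto intro: rotation_orbit_derivative cont s L punctured_test_smooth simp: rotate_by_2pi)
    moreover have "(\<lambda>t. (?LL (rotate_by t x))\<^sup>2) integrable_on {0..2 * pi}"
      "(\<lambda>t. (?L (rotate_by t x))\<^sup>2) integrable_on {0..2 * pi}"
      by (intro integrable_continuous_real continuous_intros cont L)+
    ultimately show "0 \<le> integral {0..2 * pi} (\<lambda>t. ?LL (rotate_by t x) * ?LL (rotate_by t x)
        - ?L (rotate_by t x) * ?L (rotate_by t x))"
      by (simp add: Henstock_Kurzweil_Integration.integral_diff flip: power2_eq_square)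
  qed
  then show ?thesis
    using L unfolding spherical_inner_eq_angular[abs_def] spherical_lap_eq_angular[OF s]
    by (simp add: radial_integral_diff punctured_test_simps punctured_test_smooth)
qed

end

lemma spherical_gap:
  fixes f :: "real^'n::finite \<Rightarrow> real"
  assumes f: "punctured_test f" and n: "CARD('n) \<ge> 2"
  shows "(real CARD('n) - 1) * radial_integral p (spherical_inner f f)
    \<le> radial_integral p (\<lambda>x. spherical_lap f x * spherical_lap f x)"
proof (cases "CARD('n) = 2")
  case True
  then obtain i j :: 'n where "UNIV = {i, j}" "i \<noteq> j" by (auto simp: card_2_iff)
  then interpret plane i j by unfold_locales
  show ?thesis using spherical_gap_plane[OF f, of p] True by simp
next
  case False
  then show ?thesis using spherical_gap_ge_3[OF f] n by simp
qed

section \<open>Complex-valued test functions\<close>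

lemma pd_bounded_linear_compose:
  assumes "smooth f" "bounded_linear L"
  shows "pd i (\<lambda>x. L (f x)) x = L (partial_deriv i f x)"
proof -
  have "((\<lambda>x. L (f x)) has_derivative (\<lambda>v. L (frechet_derivative f (at x) v))) (at x)"
    using assms smooth_differentiable frechet_derivative_works
    by (intro bounded_linear.has_derivative[OF assms(2)]) blast
  then show ?thesis by (simp add: pd_eqI partial_deriv_def)
qed

lemma smooth_partial_deriv: "smooth f \<Longrightarrow> smooth (partial_deriv i f)"
  unfolding partial_deriv_def[abs_def] by (rule smooth_frechet_derivative)

lemma lap_bounded_linear_compose:
  assumes "smooth f" "bounded_linear L"
  shows "lap (\<lambda>x. L (f x)) x = L (laplacian f x)"
proof -
  have "pd i (\<lambda>x. L (f x)) = (\<lambda>x. L (partial_deriv i f x))" for i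
    using assms by (intro ext pd_bounded_linear_compose)
  then show ?thesis
    using assms by (simp add: lap_def laplacian_def pd_bounded_linear_compose smooth_partial_deriv
        linear_sum bounded_linear.linear)
qed

lemma punctured_test_bounded_linear_compose:
  fixes f :: "real^'n::finite \<Rightarrow> complex"
  assumes f: "f \<in> test_functions (UNIV - {0})" and L: "bounded_linear L"
  shows "punctured_test (\<lambda>x. L (f x))"
proof -
  let ?S = "closure {x. f x \<noteq> 0}"
  have S: "smooth f" "compact ?S" "0 \<notin> ?S"
    using f by (auto simp: test_functions_def)
  obtain b where b: "\<And>x. x \<in> ?S \<Longrightarrow> norm x \<le> b"
    using compact_imp_bounded[OF S(2)] by (auto simp: bounded_iff)
  \<comment> \<open>The closed support misses the origin, hence misses a ball around it: this gives
    the inner radius.\<close>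
  have "open (- ?S)" "0 \<in> - ?S" using S(3) by auto
  then obtain a where a: "a > 0" "ball 0 a \<subseteq> - ?S"
    unfolding open_contains_ball by blast
  have "a \<le> norm x \<and> norm x \<le> b" if "L (f x) \<noteq> 0" for x
  proof -
    have "x \<in> ?S"
      using that linear_0[OF bounded_linear.linear[OF L]] closure_subset[of "{x. f x \<noteq> 0}"] by auto
    moreover from this have "\<not> norm x < a" using a(2) by auto
    ultimately show ?thesis using b by simp
  qed
  then show ?thesis
    unfolding punctured_test_def using a(1) smooth_bounded_linear_compose[OF L S(1)] by blast
qed

lemma integral_powr_norm_square_Re_Im:
  fixes h :: "real^'n::finite \<Rightarrow> complex"
  assumes "punctured_test (\<lambda>x. Re (h x))" "punctured_test (\<lambda>x. Im (h x))"
  shows "(LINT x|lborel. norm x powr p * (norm (h x))\<^sup>2) =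
    radial_integral p (\<lambda>x. Re (h x) * Re (h x)) + radial_integral p (\<lambda>x. Im (h x) * Im (h x))"
proof -
  have "(LINT x|lborel. norm x powr p * (norm (h x))\<^sup>2) =
      radial_integral p (\<lambda>x. Re (h x) * Re (h x) + Im (h x) * Im (h x))"
    by (simp add: radial_integral_def cmod_power2 flip: power2_eq_square)
  then show ?thesis
    using assms by (simp add: radial_integral_add punctured_test_mult_left punctured_test_smooth)
qed

text \<open>The differential operators have real coefficients, so each of the three integrals is the
  sum of its values for the real and imaginary parts, and the two real inequalities add up.\<close>

lemma rellich_inequality_test_functions:
  fixes f :: "real^'n::finite \<Rightarrow> complex"
  assumes f: "f \<in> test_functions (UNIV - {0})" and n: "n = real CARD('n)" "CARD('n) \<ge> 2"
    and s: "((\<gamma> - 2)\<^sup>2 \<le> n - 1 \<and> s \<ge> - (1/2) * ((n - 2)\<^sup>2 + (\<gamma> - 2)\<^sup>2)) \<or>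
      ((\<gamma> - 2)\<^sup>2 \<ge> n - 1 \<and> s \<ge> - (1/2) * ((n - 2)\<^sup>2 - (\<gamma> - 2)\<^sup>2) + 1 - n)"
  shows "rellich_inequality \<gamma> s f"
proof -
  let ?u = "\<lambda>x. Re (f x)" and ?v = "\<lambda>x. Im (f x)"
  have sf: "smooth f" using f by (simp add: test_functions_def)
  note L = bounded_linear_Re bounded_linear_Im
  have u: "punctured_test ?u" and v: "punctured_test ?v"
    using punctured_test_bounded_linear_compose[OF f] L by blast+
  have lap: "Re (laplacian f x) = lap ?u x" "Im (laplacian f x) = lap ?v x" for x
    using lap_bounded_linear_compose[OF sf] L by metis+
  have pd: "Re (partial_deriv k f x) = pd k ?u x" "Im (partial_deriv k f x) = pd k ?v x" for k x
    using pd_bounded_linear_compose[OF sf] L by metis+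
  have 1: "(LINT x|lborel. norm x powr \<gamma> * (norm (laplacian f x))\<^sup>2) =
      radial_integral \<gamma> (\<lambda>x. lap ?u x * lap ?u x) + radial_integral \<gamma> (\<lambda>x. lap ?v x * lap ?v x)"
    using integral_powr_norm_square_Re_Im[of "laplacian f" \<gamma>] punctured_test_lap[OF u] punctured_test_lap[OF v]
    by (simp add: lap)
  have 2: "(LINT x|lborel. norm x powr (\<gamma> - 4) * (norm (f x))\<^sup>2) =
      radial_integral (\<gamma> - 4) (\<lambda>x. ?u x * ?u x) + radial_integral (\<gamma> - 4) (\<lambda>x. ?v x * ?v x)"
    using integral_powr_norm_square_Re_Im[OF u v] .
  have "(norm (gradient f x))\<^sup>2 = (\<Sum>k\<in>UNIV. pd k ?u x * pd k ?u x) + (\<Sum>k\<in>UNIV. pd k ?v x * pd k ?v x)" for x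
    by (simp add: gradient_def norm_vec_def L2_set_def sum_nonneg cmod_power2 pd power2_eq_square[of "pd _ _ _"]
        sum.distrib)
  then have 3: "(LINT x|lborel. norm x powr (\<gamma> - 2) * (norm (gradient f x))\<^sup>2) =
      radial_integral (\<gamma> - 2) (\<lambda>x. \<Sum>k\<in>UNIV. pd k ?u x * pd k ?u x)
      + radial_integral (\<gamma> - 2) (\<lambda>x. \<Sum>k\<in>UNIV. pd k ?v x * pd k ?v x)"
    using u v
    by (subst radial_integral_add[symmetric])
      (simp_all add: punctured_test_simps smooth_op_simps radial_integral_def)
  show ?thesis
    unfolding rellich_inequality_def Let_def 1 2 3
    using rellich_inequality_real[OF u n(1) spherical_gap[OF u n(2), folded n(1)] s]
      rellich_inequality_real[OF v n(1) spherical_gap[OF v n(2), folded n(1)] s]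
    unfolding n(1) by (simp add: distrib_left)
qed

theorem theorem3p16:
  fixes \<gamma> :: real and n :: nat
  assumes "n = CARD('n::finite)" and "n \<ge> 2"
  shows
    "(\<gamma> \<in> {2 - sqrt (real n - 1) .. 2 + sqrt (real n - 1)} \<longrightarrow>
       (\<forall>f \<in> test_functions (UNIV - {0 :: real^'n}).
         \<forall>s \<in> {- (1/2) * ((real n - 2)\<^sup>2 + (\<gamma> - 2)\<^sup>2) ..}. rellich_inequality \<gamma> s f)) \<and>
     (\<gamma> \<in> UNIV - {2 - sqrt (real n - 1) .. 2 + sqrt (real n - 1)} \<longrightarrow>
       (\<forall>f \<in> test_functions (UNIV - {0 :: real^'n}).
         \<forall>s \<in> {- (1/2) * ((real n - 2)\<^sup>2 - (\<gamma> - 2)\<^sup>2) + 1 - real n ..}. rellich_inequality \<gamma> s f))"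
proof -
  have n: "real n = real CARD('n)" "CARD('n) \<ge> 2" "real n - 1 \<ge> 0" using assms by simp_all
  have interval: "\<gamma> \<in> {2 - sqrt (real n - 1) .. 2 + sqrt (real n - 1)} \<longleftrightarrow> (\<gamma> - 2)\<^sup>2 \<le> real n - 1"
  proof -
    have "\<gamma> \<in> {2 - sqrt (real n - 1) .. 2 + sqrt (real n - 1)} \<longleftrightarrow> \<bar>\<gamma> - 2\<bar> \<le> sqrt (real n - 1)"
      by (auto simp: abs_le_iff)
    also have "\<dots> \<longleftrightarrow> (\<gamma> - 2)\<^sup>2 \<le> real n - 1"
      using n(3) abs_le_square_iff[of "\<gamma> - 2" "sqrt (real n - 1)"] by simp
    finally show ?thesis .
  qed
  \<comment> \<open>Outside the interval the strict inequality is weakened to the second alternative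
    of the hypothesis on \<open>s\<close>.\<close>
  show ?thesis
    using interval rellich_inequality_test_functions[OF _ n(1,2)] by auto
qed

end
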